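(* Let $r\geq s\geq 2$ be integers, let $n>r^{8}$ be an integer, and let $G$ be a graph of order $n$ with $k_{s}(G)\geq k_{s}(T_{r}(n))$. Then \[ \mathrm{js}_{r+1}(G)>\frac{n^{r-1}}{(4r)^{r+6}} \] unless $G$ is isomorphic to $T_{r}(n)$.
   Context: All graphs are finite and simple. For a graph $G$, $k_{t}(G)$ denotes the number of $t$-cliques (complete subgraphs on $t$ vertices) of $G$. $T_{r}(n)$ denotes the $r$-partite Turán graph of order $n$, i.e. the complete $r$-partite graph on $n$ vertices whose $r$ vertex classes have sizes differing by at most one. An $r$-joint of size $t$ in $G$ is a collection of $t$ distinct $r$-cliques of $G$ all containing a common edge (two cliques of the joint may share up to $r-1$ vertices). $\mathrm{js}_{r}(G)$ denotes the maximum size of an $r$-joint in $G$, i.e. the maximum over all edges $e$ of $G$ of the number of $r$-cliques of $G$ containing $e$. *)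

theory Defs
  imports Complex_Main "HOL-Library.Ramsey"
begin

text \<open>A graph is a pair of a vertex set and a set of edges, each edge being a two-element set of
  vertices. \<open>[A]\<^bsup>k\<^esup>\<close> (\<^const>\<open>nsets\<close>) is the set of \<open>k\<close>-element subsets of \<open>A\<close>.\<close>

type_synonym 'a ugraph = "'a set \<times> 'a set set"

abbreviation uverts :: "'a ugraph \<Rightarrow> 'a set" where
  "uverts G \<equiv> fst G"

abbreviation uedges :: "'a ugraph \<Rightarrow> 'a set set" where
  "uedges G \<equiv> snd G"

definition finite_simple_graph :: "'a ugraph \<Rightarrow> bool" where
  "finite_simple_graph G \<longleftrightarrow> finite (uverts G) \<and> uedges G \<subseteq> [uverts G]\<^bsup>2\<^esup>"

definition graph_isomorphic :: "'a ugraph \<Rightarrow> 'b ugraph \<Rightarrow> bool" where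
  "graph_isomorphic G H \<longleftrightarrow>
     (\<exists>f. bij_betw f (uverts G) (uverts H) \<and>
          (\<forall>u\<in>uverts G. \<forall>v\<in>uverts G. {u, v} \<in> uedges G \<longleftrightarrow> {f u, f v} \<in> uedges H))"

definition cliques :: "nat \<Rightarrow> 'a ugraph \<Rightarrow> 'a set set" where
  "cliques t G = {K \<in> [uverts G]\<^bsup>t\<^esup>. [K]\<^bsup>2\<^esup> \<subseteq> uedges G}"

definition num_cliques :: "nat \<Rightarrow> 'a ugraph \<Rightarrow> nat" where
  "num_cliques t G = card (cliques t G)"

definition is_joint :: "nat \<Rightarrow> 'a ugraph \<Rightarrow> 'a set set \<Rightarrow> bool" where
  "is_joint r G J \<longleftrightarrow> J \<subseteq> cliques r G \<and> (\<exists>e\<in>uedges G. \<forall>K\<in>J. e \<subseteq> K)"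

text \<open>The inserted \<open>0\<close> only matters for a graph without edges, which has no joints at all;
  see \<open>joint_number_eq_Max_edges\<close> below.\<close>

definition joint_number :: "nat \<Rightarrow> 'a ugraph \<Rightarrow> nat" where
  "joint_number r G = Max (insert 0 {card J | J. is_joint r G J})"

definition complete_multipartite :: "'a set \<Rightarrow> ('a \<Rightarrow> 'b) \<Rightarrow> 'a ugraph" where
  "complete_multipartite V c = (V, {{u, v} | u v. u \<in> V \<and> v \<in> V \<and> c u \<noteq> c v})"

text \<open>The vertex classes of the Turan graph are the residue classes modulo \<open>r\<close> in \<open>{0, \<dots>, n - 1}\<close>,
  whose sizes differ by at most one (\<open>turan_classes_balanced\<close>).\<close>

definition turan_graph :: "nat \<Rightarrow> nat \<Rightarrow> nat ugraph" where
  "turan_graph r n = complete_multipartite {..<n} (\<lambda>i. i mod r)"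

lemma turan_classes_balanced:
  fixes r n i j :: nat
  assumes "i < r" "j < r"
  shows "card {v \<in> {..<n}. v mod r = i} \<le> card {v \<in> {..<n}. v mod r = j} + 1"
proof -
  let ?A = "{v \<in> {..<n}. v mod r = i}" and ?B = "{v \<in> {..<n}. v mod r = j}"
  let ?g = "\<lambda>v. v - i - r + j"
  have *: "\<exists>q. v = i + r + q * r" if "v \<in> ?A - {i}" for v
  proof -
    have v: "v = i + (v div r) * r"
      using that div_mult_mod_eq[of v r] by auto
    with that have "v div r \<noteq> 0" by (metis DiffD2 add.right_neutral insertCI mult_0)
    then obtain q where "v div r = Suc q" by (cases "v div r") auto
    with v have "v = i + r + q * r" by simp
    then show ?thesis ..
  qed
  have "card (?A - {i}) \<le> card ?B"
  proof (rule card_inj_on_le)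
    show "inj_on ?g (?A - {i})"
    proof (rule inj_onI)
      fix x y assume "x \<in> ?A - {i}" "y \<in> ?A - {i}" and g: "?g x = ?g y"
      then obtain p q where "x = i + r + p * r" "y = i + r + q * r" using * by meson
      with g show "x = y" by simp
    qed
    show "?g ` (?A - {i}) \<subseteq> ?B"
    proof
      fix w assume "w \<in> ?g ` (?A - {i})"
      then obtain v where v: "v \<in> ?A - {i}" "w = ?g v" by blast
      then obtain q where q: "v = i + r + q * r" using * by meson
      with v have "w = j + q * r" by simp
      with v q assms show "w \<in> ?B" by auto
    qed
  qed simp
  moreover have "card ?A \<le> card (?A - {i}) + 1"
    unfolding card_Diff_singleton_if by simp arith
  ultimately show ?thesis by linarith
qed

lemma joint_number_eq_Max_edges:
  assumes "finite_simple_graph G" and "uedges G \<noteq> {}"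
  shows "joint_number r G = Max ((\<lambda>e. card {K \<in> cliques r G. e \<subseteq> K}) ` uedges G)"
proof -
  let ?c = "\<lambda>e. card {K \<in> cliques r G. e \<subseteq> K}"
  have fV: "finite (uverts G)" and E: "uedges G \<subseteq> [uverts G]\<^bsup>2\<^esup>"
    using assms by (auto simp: finite_simple_graph_def)
  have fE: "finite (uedges G)"
    using E fV by (meson finite_imp_finite_nsets finite_subset)
  have fK: "finite (cliques r G)"
    unfolding cliques_def using fV by (simp add: finite_imp_finite_nsets)
  have fJ: "finite {card J | J. is_joint r G J}"
  proof (rule finite_subset)
    show "{card J | J. is_joint r G J} \<subseteq> card ` Pow (cliques r G)"
      by (auto simp: is_joint_def)
  qed (use fK in simp)
  show ?thesis
  proof (rule antisym)
    have "card J \<le> Max (?c ` uedges G)" if J: "is_joint r G J" for J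
    proof -
      from J obtain e where e: "e \<in> uedges G" "J \<subseteq> {K \<in> cliques r G. e \<subseteq> K}"
        by (auto simp: is_joint_def)
      then have "card J \<le> ?c e" using fK by (intro card_mono) auto
      also have "\<dots> \<le> Max (?c ` uedges G)" using e fE by (intro Max_ge) auto
      finally show ?thesis .
    qed
    then show "joint_number r G \<le> Max (?c ` uedges G)"
      unfolding joint_number_def using fJ by (intro Max.boundedI) auto
  next
    have "?c e \<le> joint_number r G" if "e \<in> uedges G" for e
    proof -
      have "is_joint r G {K \<in> cliques r G. e \<subseteq> K}" using that by (auto simp: is_joint_def)
      then show ?thesis unfolding joint_number_def using fJ by (intro Max_ge) auto
    qed
    then show "Max (?c ` uedges G) \<le> joint_number r G"
      using fE assms(2) by (intro Max.boundedI) auto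
  qed
qed

end

(* Suppose every edge lies in at most n^(r-1)/(4r)^(r+6) cliques of order r+1, so that G and all its
   vertex links contain few cliques of order r+1 and r respectively.  The Moon-Moser inequalities then
   bound the number of t-cliques of G, and of the links, almost as in the clique-free case.  Hence a
   vertex of degree below (1-1/r)(1-1/r^4)m in a subgraph of order m > n/2 lies in noticeably fewer
   s-cliques than a vertex of minimum degree in T_r(m), and deleting it increases the surplus of
   s-cliques over the Turan graph.  Deleting about n/2 such vertices would contradict the global bound,
   so the process stops at a subgraph of large minimum degree.  There a single (r+1)-clique would
   yield, by convexity of the codegree sum over its pairs, an edge of large codegree, and greedy
   extension of this edge a large joint.  So the subgraph is K_(r+1)-free, and Zykov's theorem with its
   uniqueness part shows that nothing was deleted and that G is the Turan graph. *)

theory Submission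
  imports Defs "HOL-Analysis.Convex"
begin

section \<open>Counting cliques and common neighbourhoods\<close>

text \<open>The degree threshold balances two demands. If all degrees are (1 - 1/r)m, the average
  codegree over the pairs of an (r+1)-clique exceeds (1 - 2/r)m by only 2m/(r^2(r+1)). A relative
  deficit y of the degrees spends at most half of this when y(r-1) \<le> 1/(r^2(r+1)), and y = 1/r^4
  qualifies. Deletion in turn needs y to outweigh two disturbances, each kept to y/4. One is the
  rounding of class sizes, at most one vertex out of m/r, which is small enough once m \<ge> 4r^5
  (guaranteed by n > r^8 and m \<ge> n/2). The other is the correction for the few r-cliques in a
  link, made small by the power of r in the joint bound. The remaining gap of y/2 yields a gain
  proportional to y/4 per deletion. Stopping near n/2 is a compromise: the deletions made by then
  accumulate enough surplus, while the loss of 2^(r-1) in passing from n to m is absorbed by the 4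
  in (4r)^(r+6).\<close>

locale loopless =
  fixes E :: "'a set set"
  assumes no_loop: "{v} \<notin> E"
begin

text \<open>The edge set is fixed and only the vertex set varies, so subgraphs and links are simply
  sets \<open>W\<close>. Edges of \<open>E\<close> that leave \<open>W\<close> are invisible to the
  cliques in \<open>W\<close>.\<close>

abbreviation clq :: "nat \<Rightarrow> 'a set \<Rightarrow> 'a set set" where
  "clq t W \<equiv> cliques t (W, E)"

abbreviation k :: "nat \<Rightarrow> 'a set \<Rightarrow> nat" where
  "k t W \<equiv> num_cliques t (W, E)"

text \<open>One notion covers \<open>W\<close> itself (\<open>A\<close> empty), links
  (\<open>A\<close> a singleton), codegrees (\<open>A\<close> an edge) and the one-vertex extensions
  of a clique.\<close>

definition common_nbrs :: "'a set \<Rightarrow> 'a set \<Rightarrow> 'a set" where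
  "common_nbrs W A = {w \<in> W. \<forall>a\<in>A. {a, w} \<in> E}"

lemma clq_iff:
  "K \<in> clq t W \<longleftrightarrow>
    K \<subseteq> W \<and> finite K \<and> card K = t \<and> (\<forall>u\<in>K. \<forall>v\<in>K. u \<noteq> v \<longrightarrow> {u, v} \<in> E)"
proof -
  have "[K]\<^bsup>2\<^esup> \<subseteq> E \<longleftrightarrow> (\<forall>u\<in>K. \<forall>v\<in>K. u \<noteq> v \<longrightarrow> {u, v} \<in> E)"
    unfolding nsets_2_eq by auto
  then show ?thesis by (auto simp: cliques_def nsets_def)
qed

lemma common_nbrs_subset: "common_nbrs W A \<subseteq> W"
  by (auto simp: common_nbrs_def)

lemma finite_common_nbrs [simp]: "finite W \<Longrightarrow> finite (common_nbrs W A)"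
  by (rule finite_subset[OF common_nbrs_subset])

lemma common_nbrs_common_nbrs: "common_nbrs (common_nbrs W A) B = common_nbrs W (A \<union> B)"
  by (auto simp: common_nbrs_def)

lemma common_nbrs_disjoint: "A \<inter> common_nbrs W A = {}"
  using no_loop by (force simp: common_nbrs_def)

lemma common_nbrs_mono: "W \<subseteq> W' \<Longrightarrow> common_nbrs W A \<subseteq> common_nbrs W' A"
  by (auto simp: common_nbrs_def)

lemma finite_clq [simp]: "finite W \<Longrightarrow> finite (clq t W)"
  by (rule finite_subset[of _ "Pow W"]) (auto simp: clq_iff)

lemma clq_mono:
  assumes "W \<subseteq> W'"
  shows "clq t W \<subseteq> clq t W'"
proof
  fix K assume "K \<in> clq t W"
  then show "K \<in> clq t W'"
    using assms by (simp add: clq_iff) (erule conjE, erule (1) subset_trans)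
qed

lemma k_mono: "finite W' \<Longrightarrow> W \<subseteq> W' \<Longrightarrow> k t W \<le> k t W'"
  unfolding num_cliques_def by (intro card_mono clq_mono) auto

lemma k_0 [simp]: "k 0 W = 1"
proof -
  have "clq 0 W = {{}}" by (auto simp: clq_iff)
  then show ?thesis by (simp add: num_cliques_def)
qed

lemma k_1 [simp]: "k (Suc 0) W = card W"
proof -
  have "clq 1 W = (\<lambda>v. {v}) ` W" by (auto simp: clq_iff card_1_singleton_iff)
  then show ?thesis by (simp add: num_cliques_def card_image)
qed

lemma k_empty [simp]: "k (Suc t) {} = 0"
proof -
  have "clq (Suc t) {} = {}" by (auto simp: clq_iff)
  then show ?thesis by (simp add: num_cliques_def)
qed

lemma clq_insert:
  assumes "K \<in> clq t W" "w \<in> common_nbrs W K"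
  shows "insert w K \<in> clq (Suc t) W" "w \<notin> K"
proof -
  show "w \<notin> K" using assms common_nbrs_disjoint by blast
  with assms show "insert w K \<in> clq (Suc t) W"
    by (auto simp: clq_iff common_nbrs_def insert_commute)
qed

lemma clq_remove:
  assumes "K \<in> clq (Suc t) W" "w \<in> K"
  shows "K - {w} \<in> clq t W" "w \<in> common_nbrs W (K - {w})"
  using assms by (auto simp: clq_iff common_nbrs_def)

lemma clq_subset: "K \<in> clq t W \<Longrightarrow> L \<subseteq> K \<Longrightarrow> L \<in> clq (card L) W"
  by (auto simp: clq_iff intro: finite_subset)

text \<open>Both sides sum over cliques of order \<open>Suc t\<close> with a marked vertex; the left
  side groups them by what remains without that vertex. The weight is arbitrary because
  \<open>moon_moser\<close> takes for it the degree of the remaining clique.\<close>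

lemma sum_clq_Suc:
  fixes f :: "'a set \<Rightarrow> 'a \<Rightarrow> 'b::comm_monoid_add"
  assumes "finite W"
  shows "(\<Sum>K\<in>clq t W. \<Sum>w\<in>common_nbrs W K. f K w) = (\<Sum>K\<in>clq (Suc t) W. \<Sum>w\<in>K. f (K - {w}) w)"
proof -
  have fin: "finite K" if "K \<in> clq t' W" for K t' using that by (simp add: clq_iff)
  have "(\<Sum>K\<in>clq t W. \<Sum>w\<in>common_nbrs W K. f K w)
      = (\<Sum>(K,w)\<in>Sigma (clq t W) (common_nbrs W). f K w)"
    using assms by (intro sum.Sigma) auto
  also have "\<dots> = (\<Sum>(K,w)\<in>Sigma (clq (Suc t) W) (\<lambda>K. K). f (K - {w}) w)"
    by (rule sum.reindex_bij_witness
        [where i = "\<lambda>(K, w). (K - {w}, w)" and j = "\<lambda>(K, w). (insert w K, w)"])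
       (auto dest: clq_insert clq_remove simp: insert_absorb)
  also have "\<dots> = (\<Sum>K\<in>clq (Suc t) W. \<Sum>w\<in>K. f (K - {w}) w)"
    using assms fin by (intro sum.Sigma[symmetric]) auto
  finally show ?thesis .
qed

lemma sum_card_common_nbrs:
  assumes "finite W"
  shows "(\<Sum>K\<in>clq t W. card (common_nbrs W K)) = Suc t * k (Suc t) W"
proof -
  have "(\<Sum>K\<in>clq t W. card (common_nbrs W K)) = (\<Sum>K\<in>clq t W. \<Sum>w\<in>common_nbrs W K. 1)" by simp
  also have "\<dots> = (\<Sum>K\<in>clq (Suc t) W. \<Sum>w\<in>K. 1)" using assms by (rule sum_clq_Suc)
  also have "\<dots> = (\<Sum>K\<in>clq (Suc t) W. Suc t)" by (intro sum.cong) (auto simp: clq_iff)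
  finally show ?thesis by (simp add: num_cliques_def)
qed

lemma clq_extension_bound:
  fixes x :: real
  assumes "finite W" "\<And>K. K \<in> clq t W \<Longrightarrow> x \<le> card (common_nbrs W K)"
  shows "x * k t W \<le> Suc t * k (Suc t) W"
proof -
  have "x * k t W = (\<Sum>K\<in>clq t W. x)" by (simp add: num_cliques_def)
  also have "\<dots> \<le> (\<Sum>K\<in>clq t W. real (card (common_nbrs W K)))" using assms(2) by (intro sum_mono)
  also have "\<dots> = real (\<Sum>K\<in>clq t W. card (common_nbrs W K))" by simp
  also have "\<dots> = Suc t * k (Suc t) W" unfolding sum_card_common_nbrs[OF assms(1)] by simp
  finally show ?thesis .
qed

text \<open>Removing \<open>A\<close> and adding it back are inverse to each other. For an edge
  \<open>A\<close> this identifies the joint at \<open>A\<close> with the cliques in its common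
  neighbourhood.\<close>

lemma card_clq_superset:
  assumes "A \<in> clq a W"
  shows "card {K \<in> clq (t + a) W. A \<subseteq> K} = k t (common_nbrs W A)"
proof -
  have A: "A \<subseteq> W" "finite A" "card A = a" "\<And>u v. u \<in> A \<Longrightarrow> v \<in> A \<Longrightarrow> u \<noteq> v \<Longrightarrow> {u, v} \<in> E"
    using assms by (auto simp: clq_iff)
  have "bij_betw (\<lambda>K. K - A) {K \<in> clq (t + a) W. A \<subseteq> K} (clq t (common_nbrs W A))"
  proof (rule bij_betw_byWitness[where f' = "\<lambda>K. K \<union> A"])
    show "(\<lambda>K. K - A) ` {K \<in> clq (t + a) W. A \<subseteq> K} \<subseteq> clq t (common_nbrs W A)"
    proof clarify
      fix K assume K: "K \<in> clq (t + a) W" "A \<subseteq> K"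
      then have "card (K - A) = t" using A by (simp add: card_Diff_subset clq_iff)
      moreover have "{a, x} \<in> E" if "a \<in> A" "x \<in> K - A" for a x
        using that K by (auto simp: clq_iff)
      ultimately show "K - A \<in> clq t (common_nbrs W A)"
        using K by (auto simp: clq_iff common_nbrs_def)
    qed
    show "(\<lambda>K. K \<union> A) ` clq t (common_nbrs W A) \<subseteq> {K \<in> clq (t + a) W. A \<subseteq> K}"
    proof clarify
      fix K assume K: "K \<in> clq t (common_nbrs W A)"
      then have "K \<inter> A = {}" using common_nbrs_disjoint[of A W] by (auto simp: clq_iff)
      then have "card (K \<union> A) = t + a" using A K by (simp add: card_Un_disjoint clq_iff)
      moreover have "{u, v} \<in> E" if "u \<in> K \<union> A" "v \<in> K \<union> A" "u \<noteq> v" for u v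
        using that K A(4) by (auto simp: clq_iff common_nbrs_def subset_iff) (metis insert_commute)
      ultimately show "K \<union> A \<in> clq (t + a) W \<and> A \<subseteq> K \<union> A"
        using K A common_nbrs_subset[of W A] by (auto simp: clq_iff)
    qed
    show "\<forall>K\<in>clq t (common_nbrs W A). K \<union> A - A = K"
    proof
      fix K assume "K \<in> clq t (common_nbrs W A)"
      then have "K \<inter> A = {}" using common_nbrs_disjoint[of A W] by (auto simp only: clq_iff)
      then show "K \<union> A - A = K" by blast
    qed
  qed auto
  then show ?thesis unfolding num_cliques_def by (rule bij_betw_same_card)
qed

lemma clq_singleton: "v \<in> W \<Longrightarrow> {v} \<in> clq (Suc 0) W"
  by (auto simp: clq_iff)

lemma k_remove_vertex:
  assumes "finite W" "v \<in> W"
  shows "k (Suc t) W = k (Suc t) (W - {v}) + k t (common_nbrs W {v})"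
proof -
  have "clq (Suc t) W = clq (Suc t) (W - {v}) \<union> {K \<in> clq (t + Suc 0) W. {v} \<subseteq> K}"
    by (auto simp: clq_iff)
  moreover have "card (clq (Suc t) (W - {v}) \<union> {K \<in> clq (t + Suc 0) W. {v} \<subseteq> K})
      = card (clq (Suc t) (W - {v})) + card {K \<in> clq (t + Suc 0) W. {v} \<subseteq> K}"
    using assms by (intro card_Un_disjoint) (auto simp: clq_iff)
  ultimately show ?thesis
    using card_clq_superset[OF clq_singleton[OF assms(2)]] by (simp add: num_cliques_def)
qed

lemma sum_k_common_nbrs:
  assumes "finite W"
  shows "(\<Sum>v\<in>W. k t (common_nbrs W {v})) = Suc t * k (Suc t) W"
proof -
  have "(\<Sum>v\<in>W. k t (common_nbrs W {v})) = (\<Sum>v\<in>W. card {K \<in> clq (Suc t) W. v \<in> K})"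
    using card_clq_superset[OF clq_singleton] by (intro sum.cong) auto
  also have "\<dots> = (\<Sum>v\<in>W. \<Sum>K\<in>clq (Suc t) W. if v \<in> K then 1 else 0)"
    using assms by (simp add: sum.If_cases Int_def)
  also have "\<dots> = (\<Sum>K\<in>clq (Suc t) W. \<Sum>v\<in>W. if v \<in> K then 1 else 0)"
    by (rule sum.swap)
  also have "\<dots> = (\<Sum>K\<in>clq (Suc t) W. card K)"
    using assms by (intro sum.cong) (auto simp: sum.If_cases clq_iff Int_absorb1)
  also have "\<dots> = (\<Sum>K\<in>clq (Suc t) W. Suc t)" by (intro sum.cong) (auto simp: clq_iff)
  finally show ?thesis by (simp add: num_cliques_def)
qed

text \<open>A vertex adjacent to all of \<open>K\<close> is counted \<open>Suc t\<close> times; any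
  other vertex is counted only when the removed \<open>w\<close> is its unique non-neighbour in
  \<open>K\<close>, hence at most once.\<close>

lemma sum_card_common_nbrs_remove:
  assumes "finite W" "K \<in> clq (Suc t) W"
  shows "(\<Sum>w\<in>K. card (common_nbrs W (K - {w}))) \<le> card W + t * card (common_nbrs W K)"
proof -
  have K: "finite K" "card K = Suc t" using assms by (auto simp: clq_iff)
  have "(\<Sum>w\<in>K. card (common_nbrs W (K - {w}))) = (\<Sum>w\<in>K. \<Sum>x\<in>W. if x \<in> common_nbrs W (K - {w}) then 1 else 0)"
    using assms by (simp add: sum.If_cases Int_absorb1[OF common_nbrs_subset])
  also have "\<dots> = (\<Sum>x\<in>W. \<Sum>w\<in>K. if x \<in> common_nbrs W (K - {w}) then 1 else 0)"
    by (rule sum.swap)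
  also have "\<dots> = (\<Sum>x\<in>W. card {w \<in> K. x \<in> common_nbrs W (K - {w})})"
    using K by (simp add: sum.If_cases Int_def)
  also have "\<dots> \<le> (\<Sum>x\<in>W. 1 + (if x \<in> common_nbrs W K then t else 0))"
  proof (rule sum_mono)
    fix x assume x: "x \<in> W"
    show "card {w \<in> K. x \<in> common_nbrs W (K - {w})} \<le> 1 + (if x \<in> common_nbrs W K then t else 0)"
    proof (cases "x \<in> common_nbrs W K")
      case True
      have "card {w \<in> K. x \<in> common_nbrs W (K - {w})} \<le> card K" using K by (intro card_mono) auto
      with True K show ?thesis by simp
    next
      case False
      then obtain u where u: "u \<in> K" "{u, x} \<notin> E" using x by (auto simp: common_nbrs_def)
      then have "{w \<in> K. x \<in> common_nbrs W (K - {w})} \<subseteq> {u}" by (auto simp: common_nbrs_def)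
      then have "card {w \<in> K. x \<in> common_nbrs W (K - {w})} \<le> card {u}" by (intro card_mono) auto
      with False show ?thesis by simp
    qed
  qed
  also have "\<dots> = card W + t * card (common_nbrs W K)"
    using assms unfolding sum.distrib by (simp add: sum.If_cases Int_absorb1[OF common_nbrs_subset])
  finally show ?thesis .
qed

text \<open>Cauchy-Schwarz for the degrees of the t-cliques, whose squares sum to a quantity bounded
  by the preceding lemma. A real \<open>M\<close> in place of \<open>card W\<close> lets a degree
  threshold serve as the order of a link.\<close>

theorem moon_moser:
  fixes M :: real
  assumes "finite W" "card W \<le> M"
  shows "(real (Suc t) * k (Suc t) W)\<^sup>2
    \<le> k t W * (M * k (Suc t) W + real t * real (Suc (Suc t)) * k (Suc (Suc t)) W)"
proof -
  let ?d = "\<lambda>K. real (card (common_nbrs W K))"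
  have "(real (Suc t) * k (Suc t) W)\<^sup>2 = (\<Sum>K\<in>clq t W. 1 * ?d K)\<^sup>2"
    using arg_cong[OF sum_card_common_nbrs[OF assms(1), of t], of real] by (simp add: algebra_simps)
  also have "\<dots> \<le> (\<Sum>K\<in>clq t W. 1\<^sup>2) * (\<Sum>K\<in>clq t W. (?d K)\<^sup>2)"
    by (rule Cauchy_Schwarz_ineq_sum)
  also have "\<dots> = k t W * (\<Sum>K\<in>clq t W. \<Sum>w\<in>common_nbrs W K. ?d K)"
    by (simp add: num_cliques_def power2_eq_square)
  also have "(\<Sum>K\<in>clq t W. \<Sum>w\<in>common_nbrs W K. ?d K) = (\<Sum>K\<in>clq (Suc t) W. \<Sum>w\<in>K. ?d (K - {w}))"
    using assms(1) by (rule sum_clq_Suc)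
  also have "\<dots> \<le> (\<Sum>K\<in>clq (Suc t) W. M + t * ?d K)"
  proof (rule sum_mono)
    fix K assume "K \<in> clq (Suc t) W"
    from sum_card_common_nbrs_remove[OF assms(1) this]
    have "real (\<Sum>w\<in>K. card (common_nbrs W (K - {w}))) \<le> card W + t * ?d K"
      by (metis of_nat_add of_nat_le_iff of_nat_mult)
    with assms(2) show "(\<Sum>w\<in>K. ?d (K - {w})) \<le> M + t * ?d K" by simp
  qed
  also have "\<dots> = M * k (Suc t) W + t * (\<Sum>K\<in>clq (Suc t) W. ?d K)"
    by (simp add: sum.distrib num_cliques_def sum_distrib_left)
  also have "(\<Sum>K\<in>clq (Suc t) W. ?d K) = real (Suc (Suc t)) * k (Suc (Suc t)) W"
    using arg_cong[OF sum_card_common_nbrs[OF assms(1), of "Suc t"], of real] by (simp add: algebra_simps)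
  finally show ?thesis
    by (simp only: mult.assoc) (simp add: mult_left_mono)
qed

end

section \<open>Consequences of the Moon-Moser inequality\<close>

text \<open>The bound on the number of \<open>t\<close>-cliques obtained by multiplying the Moon-Moser ratios; \<open>M\<close> is an
  upper bound for the order of the graph, and \<open>\<gamma>\<close> allows for a few cliques of order \<open>r + 1\<close>.\<close>

primrec mm_bound :: "nat \<Rightarrow> real \<Rightarrow> real \<Rightarrow> nat \<Rightarrow> real" where
  "mm_bound r M \<gamma> 0 = 1"
| "mm_bound r M \<gamma> (Suc t) = mm_bound r M \<gamma> t * (M * (real r - real t) / real r + real t * \<gamma>) / real (Suc t)"

lemma binomial_Suc_real:
  assumes "t \<le> r"
  shows "real (r choose Suc t) = (r choose t) * (real r - real t) / real (Suc t)"
proof -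
  have "Suc t * (r choose Suc t) = (r - t) * (r choose t)"
    using binomial_absorption[of t r] binomial_absorb_comp[of r t] by (simp only:)
  then have "real (Suc t) * real (r choose Suc t) = (real r - real t) * real (r choose t)"
    using assms by (metis of_nat_diff of_nat_mult)
  then show ?thesis by (simp add: eq_divide_eq mult.commute)
qed

text \<open>Without \<open>\<gamma>\<close> the product is the clique count of a complete r-partite
  graph with classes of size M/r, and \<open>\<gamma>\<close> only enlarges the factors.\<close>

lemma mm_bound_ge:
  assumes "0 \<le> M" "0 \<le> \<gamma>" "t \<le> r"
  shows "(r choose t) * (M / r) ^ t \<le> mm_bound r M \<gamma> t"
  using assms(3)
proof (induction t)
  case (Suc t)
  have "(r choose Suc t) = (r choose t) * (real r - real t) / real (Suc t)"
    using Suc.prems by (intro binomial_Suc_real) simp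
  then have "(r choose Suc t) * (M / r) ^ Suc t
      = ((r choose t) * (M / r) ^ t) * (M * (real r - real t) / r) / real (Suc t)"
    by (simp add: mult_ac)
  also have "\<dots> \<le> mm_bound r M \<gamma> t * (M * (real r - real t) / r + t * \<gamma>) / real (Suc t)"
  proof -
    have "0 \<le> (r choose t) * (M / r) ^ t" using assms(1) by simp
    also have "\<dots> \<le> mm_bound r M \<gamma> t" using Suc by simp
    finally show ?thesis using Suc assms(1,2) by (intro divide_right_mono mult_mono) auto
  qed
  finally show ?case by simp
qed simp

text \<open>With \<open>\<gamma>\<close> measured in units of M/r, the factor r - t becomes r - t +
  \<open>\<theta>\<close> t. Since t \<le> r(r - t) for t < r, it grows by a factor of at most 1 +
  r\<open>\<theta>\<close>.\<close>

lemma mm_bound_le: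
  assumes "0 \<le> M" "0 \<le> \<theta>" "t \<le> r"
  shows "mm_bound r M (\<theta> * M / r) t \<le> (r choose t) * (M / r * (1 + r * \<theta>)) ^ t"
  using assms(3)
proof (induction t)
  case (Suc t)
  have *: "(r choose Suc t) = (r choose t) * (real r - real t) / real (Suc t)"
    using Suc.prems by (intro binomial_Suc_real) simp
  have t: "real t \<le> r * (real r - real t)"
  proof -
    have "real t * 1 \<le> r * (real r - real t)" using Suc.prems by (intro mult_mono) auto
    then show ?thesis by simp
  qed
  have "M * (real r - real t) / r + t * (\<theta> * M / r) = M / r * ((real r - real t) + \<theta> * t)"
    by (simp add: algebra_simps add_divide_distrib diff_divide_distrib)
  also have "\<dots> \<le> M / r * ((real r - real t) + \<theta> * (r * (real r - real t)))"
    using assms t by (intro mult_left_mono add_left_mono) auto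
  also have "\<dots> = (real r - real t) * (M / r * (1 + r * \<theta>))" by (simp add: algebra_simps)
  finally have st: "M * (real r - real t) / r + t * (\<theta> * M / r) \<le> (real r - real t) * (M / r * (1 + r * \<theta>))" .
  have "mm_bound r M (\<theta> * M / r) (Suc t)
      \<le> ((r choose t) * (M / r * (1 + r * \<theta>)) ^ t) * ((real r - real t) * (M / r * (1 + r * \<theta>))) / real (Suc t)"
    unfolding mm_bound.simps
    using Suc assms(1,2) st by (intro divide_right_mono mult_mono) auto
  also have "\<dots> = (r choose Suc t) * (M / r * (1 + r * \<theta>)) ^ Suc t"
    unfolding * by (simp add: mult_ac)
  finally show ?case .
qed simp

section \<open>Propagation of Moon-Moser ratios\<close>

context loopless
begin

lemma k_Suc_eq_0: "finite W \<Longrightarrow> k t W = 0 \<Longrightarrow> k (Suc t) W = 0"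
  using sum_card_common_nbrs[of W t] by (simp add: num_cliques_def)

text \<open>For the ratios x(j) = (j+1) k_(j+1) / k_j, Moon-Moser reads j x(j+1) \<ge> (j+1) x(j) -
  M. The affine sequences M + c j satisfy this with equality, and the factors of
  \<open>mm_bound\<close> are the one with c = \<open>\<gamma>\<close> - M/r; so exceeding one
  factor forces exceeding the next.\<close>

lemma mm_propagate:
  fixes M \<gamma> :: real
  assumes W: "finite W" "card W \<le> M" and "0 \<le> \<gamma>" "0 < j" "j < r"
    and b: "(M * (real r - real j) / r + j * \<gamma>) * k j W < real (Suc j) * k (Suc j) W"
  shows "(M * (real r - real (Suc j)) / r + real (Suc j) * \<gamma>) * k (Suc j) W < real (Suc (Suc j)) * k (Suc (Suc j)) W"
proof -
  let ?A = "M * (real r - real j) / r + j * \<gamma>"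
  have "0 \<le> M" using W by linarith
  with assms have "0 \<le> ?A" by simp
  then have "0 \<le> ?A * k j W" by simp
  with b have "0 < real (Suc j) * k (Suc j) W" by linarith
  then have k1: "0 < real (k (Suc j) W)" using zero_less_mult_iff by fastforce
  then have k0: "0 < real (k j W)" using k_Suc_eq_0[OF W(1), of j] by (cases "k j W") auto
  have "real (k j W) * (?A * (real (Suc j) * k (Suc j) W)) = (?A * k j W) * (real (Suc j) * k (Suc j) W)" by simp
  also have "\<dots> < (real (Suc j) * k (Suc j) W) * (real (Suc j) * k (Suc j) W)"
    using b k1 by (intro mult_strict_right_mono) auto
  also have "\<dots> \<le> k j W * (M * k (Suc j) W + real j * real (Suc (Suc j)) * k (Suc (Suc j)) W)"
    using moon_moser[OF W, of j] by (simp add: power2_eq_square)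
  finally have "?A * (real (Suc j) * k (Suc j) W) < M * k (Suc j) W + real j * real (Suc (Suc j)) * k (Suc (Suc j)) W"
    using k0 by (simp only: mult_less_cancel_left_pos)
  moreover have "?A * (real (Suc j) * k (Suc j) W) - M * k (Suc j) W
      = real j * ((M * (real r - real (Suc j)) / r + real (Suc j) * \<gamma>) * k (Suc j) W)"
    using assms(5) by (simp add: field_simps)
  ultimately have "real j * ((M * (real r - real (Suc j)) / r + real (Suc j) * \<gamma>) * k (Suc j) W)
      < real j * (real (Suc (Suc j)) * k (Suc (Suc j)) W)" by (simp only: mult.assoc)
  then show ?thesis using assms(4) by (simp only: mult_less_cancel_left_pos of_nat_0_less_iff)
qed

text \<open>The ratio conditions of \<open>mm_propagate\<close> pass upwards, and if \<open>k s\<close> exceeds the product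
  \<open>mm_bound s\<close> then one of the ratios below \<open>s\<close> must exceed its factor.\<close>

lemma mm_step:
  fixes M \<gamma> :: real
  assumes W: "finite W" "card W \<le> M" and g: "0 \<le> \<gamma>" and s: "0 < s" "s \<le> r"
    and gt: "mm_bound r M \<gamma> s < k s W"
  shows "mm_bound r M \<gamma> (Suc s) < k (Suc s) W"
proof -
  let ?b = "\<lambda>j. (M * (real r - real j) / r + j * \<gamma>) * k j W < real (Suc j) * k (Suc j) W"
  have M: "0 \<le> M" using W by linarith
  have ex: "\<exists>j. 0 < j \<and> j < t \<and> ?b j" if "t \<le> s" "mm_bound r M \<gamma> t < k t W" for t
    using that
  proof (induction t)
    case (Suc t)
    show ?case
    proof (cases "mm_bound r M \<gamma> t < k t W")
      case True
      with Suc show ?thesis by (meson Suc_leD less_Suc_eq)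
    next
      case False
      have "0 \<le> M * (real r - real t) / r + t * \<gamma>" using M g Suc.prems s by simp
      with False have "(M * (real r - real t) / r + t * \<gamma>) * k t W
          \<le> (M * (real r - real t) / r + t * \<gamma>) * mm_bound r M \<gamma> t"
        by (intro mult_left_mono) auto
      also have "\<dots> = real (Suc t) * mm_bound r M \<gamma> (Suc t)" by simp
      also have "\<dots> < real (Suc t) * k (Suc t) W"
        using Suc.prems(2) by (intro mult_strict_left_mono) auto
      finally have b: "?b t" .
      \<comment> \<open>At 0 the ratio is the order of \<open>W\<close>, which cannot exceed its
        factor \<open>M\<close>; the index found is thus positive, as \<open>mm_propagate\<close>
        requires.\<close>
      have "t \<noteq> 0"
      proof
        assume "t = 0"
        with b s W show False by simp
      qed
      with b show ?thesis by blast
    qed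
  qed simp
  obtain j where j: "0 < j" "j < s" "?b j" using ex[OF order_refl gt] by blast
  have "?b t" if "j \<le> t" "t \<le> s" for t
    using that
  proof (induction t rule: dec_induct)
    case (step t)
    then show ?case using mm_propagate[OF W g, of t r] j s by simp
  qed (use j in simp)
  then have "?b s" using j by simp
  have "mm_bound r M \<gamma> (Suc s) * real (Suc s) = (M * (real r - real s) / r + s * \<gamma>) * mm_bound r M \<gamma> s" by simp
  also have "\<dots> \<le> (M * (real r - real s) / r + s * \<gamma>) * k s W"
    using M g s gt by (intro mult_left_mono) auto
  also have "\<dots> < k (Suc s) W * real (Suc s)" using \<open>?b s\<close> by (simp add: mult.commute)
  finally show ?thesis by (simp only: mult_less_cancel_right_pos of_nat_0_less_iff zero_less_Suc)
qed

text \<open>An excess at \<open>s\<close> would climb by \<open>mm_step\<close> up to order r + 1.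
  For \<open>\<gamma>\<close> = 0 the bound at \<open>Suc r\<close> is zero, because its last factor
  is; that is the clique-free case.\<close>

lemma k_le_mm_bound:
  fixes M \<gamma> :: real
  assumes W: "finite W" "card W \<le> M" and g: "0 \<le> \<gamma>" and s: "0 < s" "s \<le> Suc r"
    and le: "k (Suc r) W \<le> mm_bound r M \<gamma> (Suc r)"
  shows "k s W \<le> mm_bound r M \<gamma> s"
proof (rule ccontr)
  assume "\<not> ?thesis"
  then have gt: "mm_bound r M \<gamma> s < k s W" by simp
  have "mm_bound r M \<gamma> t < k t W" if "s \<le> t" "t \<le> Suc r" for t
    using that
  proof (induction t rule: dec_induct)
    case (step t)
    then show ?case using mm_step[OF W g, of t r] s by simp
  qed (rule gt)
  from this[of "Suc r"] s have "mm_bound r M \<gamma> (Suc r) < k (Suc r) W" by simp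
  with le show False by simp
qed

end

section \<open>Turan graphs and Zykov's theorem\<close>

text \<open>The recursion deletes a vertex from a largest class of the Turan graph of order \<open>Suc m\<close>, which has
  \<open>m div r + 1\<close> elements.\<close>

fun turan_num :: "nat \<Rightarrow> nat \<Rightarrow> nat \<Rightarrow> nat" where
  "turan_num r n 0 = 1"
| "turan_num r 0 (Suc t) = 0"
| "turan_num r (Suc m) (Suc t) = turan_num r m (Suc t) + turan_num (r - 1) (m - m div r) t"

lemma turan_num_mono: "m \<le> n \<Longrightarrow> turan_num r m t \<le> turan_num r n t"
  by (cases t) (simp, rule lift_Suc_mono_le[of "\<lambda>n. turan_num r n t"], auto)

text \<open>\<open>m - m div r\<close> is the order of the link of the vertex that
  \<open>turan_num\<close> deletes at \<open>Suc m\<close>; this link has room for a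
  (t-1)-clique.\<close>

lemma le_diff_div:
  fixes m r :: nat
  assumes "t \<le> r" "t \<le> m" "0 < r"
  shows "t - 1 \<le> m - m div r"
proof (cases "m < r")
  case False
  then have "1 \<le> m div r" using assms(3) by (simp add: Suc_leI div_greater_zero_iff)
  moreover have "(r - 1) * 1 \<le> (r - 1) * (m div r)" using calculation by (intro mult_le_mono2)
  moreover have "(r - 1) * (m div r) \<le> m - m div r"
    unfolding diff_mult_distrib mult_1 by (intro diff_le_mono times_div_less_eq_dividend)
  ultimately show ?thesis using assms by linarith
qed (use assms in simp)

lemma turan_num_pos: "t \<le> r \<Longrightarrow> t \<le> n \<Longrightarrow> 0 < turan_num r n t"
proof (induction r n t rule: turan_num.induct)
  case (3 r m t)
  show ?case
  proof (cases "Suc t \<le> m")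
    case False
    then have "t \<le> m - m div r" using 3 by simp
    with 3 show ?thesis by simp
  qed (use 3 in simp)
qed auto

text \<open>The last vertex added closes a t-clique, since its link contains a (t-1)-clique.
  Strictness is what pins down degrees in \<open>zykov_unique\<close>.\<close>

lemma turan_num_strict_mono:
  assumes "0 < t" "t \<le> r" "t \<le> n" "m < n"
  shows "turan_num r m t < turan_num r n t"
proof -
  obtain n' t' where n: "n = Suc n'" "t = Suc t'" using assms by (cases n; cases t) auto
  have "t' \<le> n' - n' div r"
  proof (cases "t \<le> n'")
    case True
    then show ?thesis using le_diff_div[of t r n'] assms n by simp
  next
    case False
    then have "n' < r" using assms by simp
    with assms n show ?thesis by simp
  qed
  then have "0 < turan_num (r - 1) (n' - n' div r) t'" using assms n by (intro turan_num_pos) auto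
  moreover have "turan_num r m t \<le> turan_num r n' t" using assms n by (intro turan_num_mono) simp
  ultimately show ?thesis using n by simp
qed

section \<open>Turan graphs as balanced colourings, and Zykov's theorem\<close>

context loopless
begin

definition turan_colouring :: "'b set \<Rightarrow> ('a \<Rightarrow> 'b) \<Rightarrow> 'a set \<Rightarrow> bool" where
  "turan_colouring C c W \<longleftrightarrow> finite C \<and> c ` W \<subseteq> C \<and>
     (\<forall>i\<in>C. \<forall>j\<in>C. card {w \<in> W. c w = i} \<le> card {w \<in> W. c w = j} + 1) \<and>
     (\<forall>u\<in>W. \<forall>v\<in>W. {u, v} \<in> E \<longleftrightarrow> c u \<noteq> c v)"

lemma turan_colouringD:
  assumes "turan_colouring C c W"
  shows "finite C" "c ` W \<subseteq> C"
    and "\<And>i j. i \<in> C \<Longrightarrow> j \<in> C \<Longrightarrow> card {w \<in> W. c w = i} \<le> card {w \<in> W. c w = j} + 1"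
    and "\<And>u v. u \<in> W \<Longrightarrow> v \<in> W \<Longrightarrow> {u, v} \<in> E \<longleftrightarrow> c u \<noteq> c v"
  using assms unfolding turan_colouring_def by blast+

lemma sum_class_sizes:
  assumes "finite W" "finite C" "c ` W \<subseteq> C"
  shows "(\<Sum>i\<in>C. card {w \<in> W. c w = i}) = card W"
  using sum.group[OF assms, of "\<lambda>_. 1::nat"] by simp

lemma class_size_lower:
  assumes "turan_colouring C c W" "finite W" "i \<in> C"
  shows "card W div card C \<le> card {w \<in> W. c w = i}"
proof (rule ccontr)
  let ?a = "\<lambda>i. card {w \<in> W. c w = i}" and ?q = "card W div card C"
  assume neg: "\<not> ?thesis"
  have "(\<Sum>j\<in>C. ?a j) < (\<Sum>j\<in>C. ?q)"
  proof (rule sum_strict_mono_ex1)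
    show "\<forall>j\<in>C. ?a j \<le> ?q"
    proof
      fix j assume "j \<in> C"
      then have "?a j \<le> ?a i + 1" using turan_colouringD(3)[OF assms(1)] assms(3) by blast
      with neg show "?a j \<le> ?q" by linarith
    qed
    show "\<exists>j\<in>C. ?a j < ?q" using neg assms(3) by (intro bexI[of _ i]) auto
  qed (rule turan_colouringD(1)[OF assms(1)])
  also have "\<dots> \<le> card W" by simp
  also have "\<dots> = (\<Sum>j\<in>C. ?a j)"
    using assms(2) turan_colouringD(1,2)[OF assms(1)] by (rule sum_class_sizes[symmetric])
  finally show False by simp
qed

lemma class_size_upper:
  assumes "turan_colouring C c W" "finite W" "i \<in> C"
  shows "card {w \<in> W. c w = i} \<le> card W div card C + 1"
proof (rule ccontr)
  let ?a = "\<lambda>i. card {w \<in> W. c w = i}" and ?q = "card W div card C"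
  have C0: "0 < card C" using assms(3) turan_colouringD(1)[OF assms(1)] by (auto simp: card_gt_0_iff)
  assume neg: "\<not> ?thesis"
  have "card W < card C * (?q + 1)"
    unfolding distrib_left mult_1_right
    using dividend_less_times_div[OF C0, of "card W"] by linarith
  also have "\<dots> = (\<Sum>j\<in>C. ?q + 1)" by simp
  also have "\<dots> \<le> (\<Sum>j\<in>C. ?a j)"
  proof (rule sum_mono)
    fix j assume "j \<in> C"
    then have "?a i \<le> ?a j + 1" using turan_colouringD(3)[OF assms(1)] assms(3) by blast
    with neg show "?q + 1 \<le> ?a j" by linarith
  qed
  also have "\<dots> = card W"
    using assms(2) turan_colouringD(1,2)[OF assms(1)] by (rule sum_class_sizes)
  finally show False by simp
qed

lemma common_nbrs_turan_colouring:
  assumes "turan_colouring C c W" "v \<in> W"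
  shows "common_nbrs W {v} = W - {w \<in> W. c w = c v}"
proof -
  have "{v, w} \<in> E \<longleftrightarrow> c w \<noteq> c v" if "w \<in> W" for w
    using turan_colouringD(4)[OF assms(1) assms(2) that] by auto
  then show ?thesis by (auto simp: common_nbrs_def)
qed

text \<open>As \<open>v\<close> lies in a largest class, its removal keeps the balance, and its link
  consists of the other classes, all intact. This mirrors one step of
  \<open>turan_num\<close>.\<close>

lemma turan_colouring_remove:
  assumes col: "turan_colouring C c W" and W: "finite W" "v \<in> W" "card W = Suc m"
    and max: "\<And>j. j \<in> C \<Longrightarrow> card {w \<in> W. c w = j} \<le> card {w \<in> W. c w = c v}"
  shows "turan_colouring C c (W - {v})"
    and "turan_colouring (C - {c v}) c (common_nbrs W {v})"
    and "card (common_nbrs W {v}) = m - m div card C"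
proof -
  let ?a = "\<lambda>i. card {w \<in> W. c w = i}" and ?b = "\<lambda>i. card {w \<in> W - {v}. c w = i}"
  have C: "finite C" "c ` W \<subseteq> C" "c v \<in> C"
    using turan_colouringD(1,2)[OF col] W by auto
  have b: "?b i = (if i = c v then ?a i - 1 else ?a i)" for i
  proof -
    have "{w \<in> W - {v}. c w = i} = {w \<in> W. c w = i} - {v}" by auto
    then show ?thesis using W by simp
  qed
  have a0: "0 < ?a (c v)" using W by (auto simp: card_gt_0_iff)
  have diff: "?a i \<le> ?a j + 1" if "i \<in> C" "j \<in> C" for i j
    using turan_colouringD(3)[OF col that] .
  show rem: "turan_colouring C c (W - {v})"
    unfolding turan_colouring_def
  proof (intro conjI ballI)
    fix i j assume "i \<in> C" "j \<in> C"
    then show "?b i \<le> ?b j + 1"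
      using max[of i] diff[of i j] a0 unfolding b
      by (cases "i = c v"; cases "j = c v") simp_all
  next
    fix u w assume "u \<in> W - {v}" "w \<in> W - {v}"
    then show "{u, w} \<in> E \<longleftrightarrow> c u \<noteq> c w"
      using turan_colouringD(4)[OF col] by blast
  qed (use C in auto)
  have "{w \<in> common_nbrs W {v}. c w = i} = {w \<in> W. c w = i}" if "i \<noteq> c v" for i
    using that common_nbrs_turan_colouring[OF col W(2)] by auto
  then show "turan_colouring (C - {c v}) c (common_nbrs W {v})"
    using C common_nbrs_turan_colouring[OF col W(2)] diff turan_colouringD(4)[OF col]
    unfolding turan_colouring_def by (intro conjI ballI) auto
  \<comment> \<open>Without \<open>v\<close> its class is a smallest one, so its size is the
    rounded-down average of m: averaging gives the upper bound, \<open>class_size_lower\<close> the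
    lower one.\<close>
  have "(\<Sum>j\<in>C. ?a (c v) - 1) \<le> (\<Sum>j\<in>C. ?b j)"
  proof (rule sum_mono)
    fix j assume "j \<in> C"
    then show "?a (c v) - 1 \<le> ?b j" using diff[of "c v" j] C(3) unfolding b by (cases "j = c v") (simp_all add: le_diff_conv)
  qed
  also have "\<dots> = card (W - {v})" using C W by (intro sum_class_sizes) auto
  also have "\<dots> = m" using W by simp
  finally have "card C * (?a (c v) - 1) \<le> m" by simp
  then have "?a (c v) - 1 \<le> m div card C"
    using C by (subst less_eq_div_iff_mult_less_eq) (auto simp: card_gt_0_iff mult.commute)
  moreover have "m div card C \<le> ?a (c v) - 1"
    using class_size_lower[OF rem _ C(3)] b[of "c v"] W by simp
  moreover have "card (common_nbrs W {v}) = Suc m - ?a (c v)"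
    unfolding common_nbrs_turan_colouring[OF col W(2)] using W by (subst card_Diff_subset) auto
  ultimately show "card (common_nbrs W {v}) = m - m div card C" using a0 by simp
qed

lemma k_turan_colouring:
  assumes "turan_colouring C c W" "finite W"
  shows "k t W = turan_num (card C) (card W) t"
proof -
  have "k t W = turan_num r n t"
    if "turan_colouring C c W" "finite W" "card C = r" "card W = n" for C W r n
    using that
  proof (induction r n t arbitrary: C W rule: turan_num.induct)
    case (3 r m t)
    let ?a = "\<lambda>i. card {w \<in> W. c w = i}"
    have "W \<noteq> {}" using 3 by auto
    then obtain v where v: "v \<in> W" "\<And>w. w \<in> W \<Longrightarrow> ?a (c w) \<le> ?a (c v)"
      using Max_in[of "(\<lambda>w. ?a (c w)) ` W"] Max_ge[of "(\<lambda>w. ?a (c w)) ` W"] 3(4)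
      by (smt (verit, best) finite_imageI image_iff image_is_empty)
    have max: "?a j \<le> ?a (c v)" for j
    proof (cases "j \<in> c ` W")
      case False
      then have "{w \<in> W. c w = j} = {}" by auto
      then show ?thesis by (simp only: card.empty)
    qed (use v in auto)
    note rm = turan_colouring_remove[OF 3(3,4) v(1) 3(6) max]
    have "c v \<in> C" using turan_colouringD(2)[OF 3(3)] v(1) by blast
    have "k (Suc t) W = k (Suc t) (W - {v}) + k t (common_nbrs W {v})"
      using 3 v by (intro k_remove_vertex)
    also have "k (Suc t) (W - {v}) = turan_num r m (Suc t)"
      using rm 3 v by (intro "3.IH"(1)[of C]) auto
    also have "k t (common_nbrs W {v}) = turan_num (r - 1) (m - m div r) t"
      using rm 3 v \<open>c v \<in> C\<close> by (intro "3.IH"(2)[of "C - {c v}"]) auto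
    finally show ?case by simp
  qed auto
  with assms show ?thesis by blast
qed

text \<open>A t-clique leaves at least r - t colours free, and every vertex of a free colour extends
  it; each class has at least the rounded-down average size.\<close>

lemma turan_colouring_k_ge:
  assumes col: "turan_colouring C c W" and W: "finite W"
  shows "(card C choose t) * real (card W div card C) ^ t \<le> k t W"
proof (induction t)
  case (Suc t)
  let ?q = "card W div card C" and ?r = "card C"
  show ?case
  proof (cases "t < ?r")
    case True
    have C: "finite C" "c ` W \<subseteq> C" "\<And>u v. u \<in> W \<Longrightarrow> v \<in> W \<Longrightarrow> {u, v} \<in> E \<longleftrightarrow> c u \<noteq> c v"
      using turan_colouringD(1,2,4)[OF col] by auto
    have "(real ?r - real t) * ?q \<le> card (common_nbrs W K)" if K: "K \<in> clq t W" for K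
    proof -
      have K': "K \<subseteq> W" "finite K" "card K = t" using K by (auto simp: clq_iff)
      have "(\<forall>a\<in>K. {a, w} \<in> E) \<longleftrightarrow> c w \<in> C - c ` K" if "w \<in> W" for w
      proof -
        have "{a, w} \<in> E \<longleftrightarrow> c w \<noteq> c a" if "a \<in> K" for a
          using C(3)[of a w] K'(1) \<open>w \<in> W\<close> that by auto
        with C(2) that show ?thesis by auto
      qed
      then have "common_nbrs W K = {w \<in> W. c w \<in> C - c ` K}"
        by (auto simp: common_nbrs_def)
      moreover have "(\<Sum>i\<in>C - c ` K. card {w \<in> {w \<in> W. c w \<in> C - c ` K}. c w = i}) = card {w \<in> W. c w \<in> C - c ` K}"
        using W C by (intro sum_class_sizes) auto
      moreover have "(\<Sum>i\<in>C - c ` K. ?q) \<le> (\<Sum>i\<in>C - c ` K. card {w \<in> {w \<in> W. c w \<in> C - c ` K}. c w = i})"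
      proof (rule sum_mono)
        fix i assume i: "i \<in> C - c ` K"
        then have "{w \<in> {w \<in> W. c w \<in> C - c ` K}. c w = i} = {w \<in> W. c w = i}" by auto
        with i show "?q \<le> card {w \<in> {w \<in> W. c w \<in> C - c ` K}. c w = i}"
          using class_size_lower[OF col W] by simp
      qed
      ultimately have "card (C - c ` K) * ?q \<le> card (common_nbrs W K)" by simp
      moreover have "?r - t \<le> card (C - c ` K)"
        using diff_card_le_card_Diff[of "c ` K" C] card_image_le[OF K'(2), of c] K' by simp
      ultimately have "(?r - t) * ?q \<le> card (common_nbrs W K)"
        by (meson le_trans mult_le_mono1)
      then have "real ((?r - t) * ?q) \<le> real (card (common_nbrs W K))" by (simp only: of_nat_le_iff)
      then show ?thesis using True by (simp add: of_nat_diff)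
    qed
    from clq_extension_bound[OF W this]
    have ext: "(real ?r - real t) * ?q * k t W \<le> real (Suc t) * k (Suc t) W" unfolding of_nat_mult .
    have "real (Suc t) * ((?r choose Suc t) * real ?q ^ Suc t) = (real ?r - real t) * ?q * ((?r choose t) * real ?q ^ t)"
      using True by (subst binomial_Suc_real) auto
    also have "\<dots> \<le> (real ?r - real t) * ?q * k t W"
      using Suc True by (intro mult_left_mono) auto
    also note ext
    finally show ?thesis by (simp only: mult_le_cancel_left_pos of_nat_0_less_iff zero_less_Suc)
  qed (simp add: binomial_eq_0)
qed simp

text \<open>Otherwise the degree sum would exceed Turan's edge bound, which is the order 2 case of
  \<open>k_le_mm_bound\<close> with \<open>\<gamma>\<close> = 0.\<close>

lemma ex_low_degree:
  assumes W: "finite W" "card W = Suc m" and free: "k (Suc r) W = 0"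
  shows "\<exists>v\<in>W. card (common_nbrs W {v}) \<le> m - m div r"
proof (rule ccontr)
  assume neg: "\<not> ?thesis"
  have r: "0 < r" using free W by (cases r) auto
  have "k 2 W \<le> mm_bound r (Suc m) 0 2"
  proof (rule k_le_mm_bound)
    show "real (k (Suc r) W) \<le> mm_bound r (Suc m) 0 (Suc r)" using free by simp
  qed (use W r in auto)
  also have "\<dots> = (Suc m) * (Suc m * (real r - 1)) / (2 * r)"
    using r by (simp add: numeral_2_eq_2)
  finally have k2: "2 * r * real (k 2 W) \<le> Suc m * (Suc m * (real r - 1))"
    using r by (simp add: field_simps)
  have "(\<Sum>v\<in>W. m - m div r + 1) \<le> (\<Sum>v\<in>W. card (common_nbrs W {v}))"
    using neg by (intro sum_mono) auto
  also have "\<dots> = 2 * k 2 W" using sum_k_common_nbrs[OF W(1), of 1] by (simp add: numeral_2_eq_2)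
  finally have "Suc m * (m - m div r + 1) \<le> 2 * k 2 W" using W by simp
  then have "real (Suc m * (m - m div r + 1)) \<le> 2 * real (k 2 W)" by linarith
  then have "r * real (Suc m * (m - m div r + 1)) \<le> r * (2 * real (k 2 W))" by (intro mult_left_mono) auto
  with k2 have "real (Suc m) * (real r * (real (m - m div r + 1))) \<le> real (Suc m) * (Suc m * (real r - 1))" by (simp only: of_nat_mult) (simp only: mult_ac)
  then have *: "real r * real (m - m div r + 1) \<le> Suc m * (real r - 1)"
    by (simp only: mult_le_cancel_left_pos of_nat_0_less_iff zero_less_Suc)
  \<comment> \<open>This contradicts \<open>*\<close>, which rearranges to m + 1 \<le> r (m div
    r).\<close>
  have "real r * real (m div r) \<le> real m"
    by (metis of_nat_le_iff of_nat_mult times_div_less_eq_dividend)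
  with * show False by (simp add: of_nat_diff algebra_simps)
qed

lemma free_common_nbrs:
  assumes "finite W" "v \<in> W" "k (Suc r) W = 0"
  shows "k r (common_nbrs W {v}) = 0" "k (Suc r) (W - {v}) = 0"
  using k_remove_vertex[OF assms(1,2), of r] assms(3) by auto

text \<open>Deleting a vertex of low degree leaves a graph without (r+1)-cliques, and its link has
  no r-cliques; the two parts follow the recursion of \<open>turan_num\<close>.\<close>

theorem zykov:
  assumes "finite W" "k (Suc r) W = 0"
  shows "k t W \<le> turan_num r (card W) t"
proof -
  \<comment> \<open>The order is only bounded by \<open>n\<close>, since a link may have fewer than
    \<open>m - m div r\<close> vertices.\<close>
  have "k t W \<le> turan_num r n t" if "finite W" "k (Suc r) W = 0" "card W \<le> n" for n
    using that
  proof (induction r n t arbitrary: W rule: turan_num.induct)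
    case (3 r m t)
    show ?case
    proof (cases "card W \<le> m")
      case False
      then have c: "card W = Suc m" using 3 by simp
      then obtain v where v: "v \<in> W" "card (common_nbrs W {v}) \<le> m - m div r"
        using ex_low_degree 3 by blast
      have "r \<noteq> 0" using 3 c by (cases r) auto
      have "k (Suc t) W = k (Suc t) (W - {v}) + k t (common_nbrs W {v})"
        using 3 v by (intro k_remove_vertex)
      also have "k (Suc t) (W - {v}) \<le> turan_num r m (Suc t)"
        using 3 v c free_common_nbrs by (intro "3.IH"(1)) auto
      also have "k t (common_nbrs W {v}) \<le> turan_num (r - 1) (m - m div r) t"
        using 3 v c free_common_nbrs \<open>r \<noteq> 0\<close> by (intro "3.IH"(2)) auto
      finally show ?thesis by simp
    qed (use 3 in \<open>simp add: trans_le_add1\<close>)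
  qed auto
  with assms show ?thesis by blast
qed

text \<open>Missing class \<open>i\<close> leaves \<open>v\<close> at most the rest as neighbours.
  No class has fewer than m div r vertices, so the prescribed degree forces class \<open>i\<close>
  to have exactly that size and \<open>v\<close> to be adjacent to everything else.\<close>

lemma turan_colouring_add:
  assumes col: "turan_colouring C c (W - {v})" and W: "finite W" "v \<in> W" "card W = Suc m"
    and d: "card (common_nbrs W {v}) = m - m div card C"
    and i: "i \<in> C" "\<And>w. w \<in> common_nbrs W {v} \<Longrightarrow> c w \<noteq> i"
  shows "turan_colouring C (c(v := i)) W"
proof -
  let ?U = "W - {v}" let ?c = "c(v := i)"
  let ?A = "{w \<in> ?U. c w = i}"
  have U: "finite ?U" "card ?U = m" using W by auto
  have "common_nbrs W {v} \<subseteq> ?U" using common_nbrs_subset common_nbrs_disjoint[of "{v}" W] by blast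
  then have sub: "common_nbrs W {v} \<subseteq> ?U - ?A" using i by auto
  have cA: "card (?U - ?A) = m - card ?A" using U by (subst card_Diff_subset) auto
  have "card ?A \<le> m" using U card_mono[of ?U ?A] by auto
  moreover have low: "m div card C \<le> card ?A" using class_size_lower[OF col U(1) i(1)] U by simp
  moreover have "m - m div card C \<le> m - card ?A"
    using card_mono[OF _ sub] U cA d by simp
  ultimately have A: "card ?A = m div card C" by linarith
  then have N: "common_nbrs W {v} = ?U - ?A" using sub cA d U by (intro card_subset_eq) auto
  have cls: "card {w \<in> W. ?c w = j} = (if j = i then Suc (m div card C) else card {w \<in> ?U. c w = j})" for j
  proof (cases "j = i")
    case True
    then have "{w \<in> W. ?c w = j} = insert v ?A" using W by auto
    with True A U show ?thesis by simp
  next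
    case False
    then have "{w \<in> W. ?c w = j} = {w \<in> ?U. c w = j}" by auto
    with False show ?thesis by simp
  qed
  show ?thesis
    unfolding turan_colouring_def
  proof (intro conjI ballI)
    show "finite C" "?c ` W \<subseteq> C" using turan_colouringD(1,2)[OF col] i by auto
    fix j l assume "j \<in> C" "l \<in> C"
    then show "card {w \<in> W. ?c w = j} \<le> card {w \<in> W. ?c w = l} + 1"
      using class_size_lower[OF col U(1), of j] class_size_upper[OF col U(1), of j]
        class_size_lower[OF col U(1), of l] class_size_upper[OF col U(1), of l]
      unfolding cls U(2) by (simp split: if_split)
  next
    fix u w assume uw: "u \<in> W" "w \<in> W"
    have vw: "{v, x} \<in> E \<longleftrightarrow> c x \<noteq> i" if "x \<in> ?U" for x
    proof -
      have "{v, x} \<in> E \<longleftrightarrow> x \<in> common_nbrs W {v}" using that by (auto simp: common_nbrs_def)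
      also have "\<dots> \<longleftrightarrow> c x \<noteq> i" using that N by auto
      finally show ?thesis .
    qed
    have UU: "{u, w} \<in> E \<longleftrightarrow> c u \<noteq> c w" if "u \<in> ?U" "w \<in> ?U"
      using turan_colouringD(4)[OF col that] .
    show "{u, w} \<in> E \<longleftrightarrow> ?c u \<noteq> ?c w"
      using uw vw[of u] vw[of w] UU no_loop[of v] by (auto simp: insert_commute)
  qed
qed

text \<open>Equality must hold in both parts of the recursion; the deleted vertex is then put back
  into a class in which it has no neighbour.\<close>

theorem zykov_unique:
  assumes "finite W" "k (Suc r) W = 0" "2 \<le> s" "s \<le> r" "s \<le> card W"
    and "turan_num r (card W) s \<le> k s W"
  shows "\<exists>c. turan_colouring {..<r} c W"
proof -
  have "\<exists>c. turan_colouring {..<r} c W"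
    if "s \<le> n" "card W = n" "finite W" "k (Suc r) W = 0" "turan_num r n s \<le> k s W" for n
    using that
  proof (induction n arbitrary: W rule: dec_induct)
    case base
    \<comment> \<open>At order \<open>s\<close> a single s-clique fills \<open>W\<close>, and r
      \<ge> s colours suffice to give its vertices distinct ones.\<close>
    then have "0 < k s W" using turan_num_pos[of s r s] assms by simp
    then obtain K where K: "K \<in> clq s W"
      by (metis card.empty equals0I num_cliques_def less_numeral_extra(3))
    then have "K = W" using base by (intro card_subset_eq) (auto simp: clq_iff)
    obtain c where c: "c ` W \<subseteq> {..<r}" "inj_on c W"
      using card_le_inj[of W "{..<r}"] base assms by auto
    have "card {w \<in> W. c w = j} \<le> 1" for j
      using c(2) base unfolding One_nat_def by (subst card_le_Suc0_iff_eq) (auto dest: inj_onD)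
    then have "card {w \<in> W. c w = i} \<le> card {w \<in> W. c w = j} + 1" for i j
      by (meson le_add2 le_trans)
    moreover have "{u, v} \<in> E \<longleftrightarrow> c u \<noteq> c v" if "u \<in> W" "v \<in> W" for u v
      using K \<open>K = W\<close> no_loop that c(2) by (cases "u = v") (auto simp: clq_iff inj_on_eq_iff)
    ultimately have "turan_colouring {..<r} c W"
      using c(1) unfolding turan_colouring_def by (intro conjI ballI) auto
    then show ?case by blast
  next
    case (step m)
    obtain v where v: "v \<in> W" "card (common_nbrs W {v}) \<le> m - m div r"
      using ex_low_degree[OF step(5) step(4) step(6)] by blast
    let ?d = "card (common_nbrs W {v})" and ?D = "m - m div r"
    obtain s' where s': "s = Suc s'" using assms by (cases s) auto
    have r: "r \<noteq> 0" using assms by simp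
    have free: "k (Suc (r - 1)) (common_nbrs W {v}) = 0" "k (Suc r) (W - {v}) = 0"
      using free_common_nbrs[OF step(5) v(1) step(6)] r by auto
    have U: "finite (W - {v})" "card (W - {v}) = m" using step v by auto
    have "k s W = k s (W - {v}) + k s' (common_nbrs W {v})"
      unfolding s' using step v by (intro k_remove_vertex)
    moreover have "turan_num r (Suc m) s = turan_num r m s + turan_num (r - 1) ?D s'" by (simp add: s')
    moreover have k1: "k s (W - {v}) \<le> turan_num r m s" using zykov[OF U(1) free(2)] U by simp
    moreover have k2: "k s' (common_nbrs W {v}) \<le> turan_num (r - 1) ?d s'"
      using zykov[OF _ free(1)] step by simp
    moreover have "turan_num (r - 1) ?d s' \<le> turan_num (r - 1) ?D s'" by (intro turan_num_mono v)
    ultimately have eq: "turan_num r m s \<le> k s (W - {v})" "turan_num (r - 1) ?d s' = turan_num (r - 1) ?D s'"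
      using step.prems by linarith+
    \<comment> \<open>Here s \<ge> 2 enters: \<open>s'\<close> is positive, so a smaller link would
      have strictly fewer cliques available.\<close>
    have d: "?d = ?D"
    proof (rule ccontr)
      assume "?d \<noteq> ?D"
      then have "turan_num (r - 1) ?d s' < turan_num (r - 1) ?D s'"
        using v s' assms step le_diff_div[of s r m] by (intro turan_num_strict_mono) auto
      with eq show False by simp
    qed
    obtain c where c: "turan_colouring {..<r} c (W - {v})"
      using step.IH[OF U(2,1) free(2) eq(1)] by blast
    \<comment> \<open>Neighbours in all r classes would form an (r+1)-clique together with
      \<open>v\<close>.\<close>
    have "\<exists>i<r. \<forall>w\<in>common_nbrs W {v}. c w \<noteq> i"
    proof (rule ccontr)
      assume "\<not> ?thesis"
      then have "\<forall>i\<in>{..<r}. \<exists>w. w \<in> common_nbrs W {v} \<and> c w = i" by auto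
      then obtain f where f: "\<And>i. i < r \<Longrightarrow> f i \<in> common_nbrs W {v}" "\<And>i. i < r \<Longrightarrow> c (f i) = i"
        by (metis lessThan_iff)
      have fU: "f i \<in> W - {v}" if "i < r" for i
        using f(1)[OF that] common_nbrs_subset[of W "{v}"] common_nbrs_disjoint[of "{v}" W] by blast
      have "inj_on f {..<r}" by (rule inj_on_inverseI[of _ c]) (simp add: f)
      then have "f ` {..<r} \<in> clq r W"
        using fU c f unfolding clq_iff turan_colouring_def by (auto simp: card_image)
      moreover have "v \<in> common_nbrs W (f ` {..<r})"
        using v f unfolding common_nbrs_def by (auto simp: insert_commute)
      ultimately have "insert v (f ` {..<r}) \<in> clq (Suc r) W" by (rule clq_insert)
      with step(5,6) show False by (auto simp: num_cliques_def)
    qed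
    then obtain i where i: "i < r" "\<And>w. w \<in> common_nbrs W {v} \<Longrightarrow> c w \<noteq> i" by blast
    then have "turan_colouring {..<r} (c(v := i)) W"
      using d step v by (intro turan_colouring_add[OF c]) auto
    then show ?case by blast
  qed
  with assms show ?thesis by blast
qed

end

section \<open>The concrete Turan graph as an instance\<close>

lemma loopless_turan: "loopless (uedges (turan_graph r n))"
  by standard (auto simp: turan_graph_def complete_multipartite_def doubleton_eq_iff)

lemma turan_colouring_turan_graph:
  assumes "0 < r"
  shows "loopless.turan_colouring (uedges (turan_graph r n)) {..<r} (\<lambda>i. i mod r) {..<n}"
  unfolding loopless.turan_colouring_def[OF loopless_turan]
  using assms turan_classes_balanced[of _ r _ n]
  by (auto simp: turan_graph_def complete_multipartite_def doubleton_eq_iff)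

lemma num_cliques_turan_graph:
  assumes "0 < r"
  shows "num_cliques t (turan_graph r n) = turan_num r n t"
  using loopless.k_turan_colouring[OF loopless_turan turan_colouring_turan_graph[OF assms], of n t]
  by (simp add: turan_graph_def complete_multipartite_def)

lemma turan_num_ge:
  assumes "0 < r"
  shows "(r choose t) * real (n div r) ^ t \<le> turan_num r n t"
  using loopless.turan_colouring_k_ge[OF loopless_turan turan_colouring_turan_graph[OF assms], of n t]
    num_cliques_turan_graph[OF assms, of t n]
  by (simp add: turan_graph_def complete_multipartite_def)

section \<open>Joints in graphs of large minimum degree\<close>

context loopless
begin

text \<open>Union bound: each vertex of \<open>T\<close> excludes at most \<open>x\<close> vertices,
  itself included.\<close>

lemma card_common_nbrs_ge:
  fixes x :: real
  assumes W: "finite W" "L \<subseteq> W" and T: "finite T"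
    and deg: "\<And>a. a \<in> T \<Longrightarrow> card W \<le> card (common_nbrs W {a}) + x"
  shows "card L - card T * x \<le> card (common_nbrs L T)"
proof -
  have "L \<subseteq> common_nbrs L T \<union> (\<Union>a\<in>T. W - common_nbrs W {a})" using W by (auto simp: common_nbrs_def)
  then have "card L \<le> card (common_nbrs L T \<union> (\<Union>a\<in>T. W - common_nbrs W {a}))"
    using W T finite_subset[OF W(2,1)] by (intro card_mono) auto
  also have "\<dots> \<le> card (common_nbrs L T) + (\<Sum>a\<in>T. card (W - common_nbrs W {a}))"
    by (rule order_trans[OF card_Un_le add_left_mono[OF card_UN_le[OF T]]])
  finally have "real (card L) \<le> card (common_nbrs L T) + (\<Sum>a\<in>T. real (card (W - common_nbrs W {a})))"
    by (metis of_nat_add of_nat_le_iff of_nat_sum)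
  also have "(\<Sum>a\<in>T. real (card (W - common_nbrs W {a}))) \<le> (\<Sum>a\<in>T. x)"
  proof (rule sum_mono)
    fix a assume "a \<in> T"
    from deg[OF this] show "real (card (W - common_nbrs W {a})) \<le> x"
      using W card_mono[OF W(1) common_nbrs_subset[of W "{a}"]]
      by (simp add: card_Diff_subset[OF _ common_nbrs_subset] of_nat_diff)
  qed
  finally show ?thesis by simp
qed

text \<open>The steps contribute factors x(p - t)/(t + 1), whose product is (p choose t) x^t. At t =
  p the main term is zero, and only the reserve \<open>z\<close> drives the last extension.\<close>

lemma greedy_cliques:
  fixes x z :: real
  assumes L: "finite L" and "0 \<le> x" "0 \<le> z"
    and ext: "\<And>t T. t \<le> p \<Longrightarrow> T \<in> clq t L \<Longrightarrow> x * (real p - real t) + z \<le> card (common_nbrs L T)"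
  shows "z * x ^ p \<le> real (Suc p) * k (Suc p) L"
proof -
  have "(p choose t) * x ^ t \<le> k t L" if "t \<le> p" for t
    using that
  proof (induction t)
    case (Suc t)
    have "x * (real p - real t) * k t L \<le> real (Suc t) * k (Suc t) L"
      unfolding of_nat_mult[symmetric]
      using Suc.prems assms(3) ext[of t] by (intro clq_extension_bound[OF L]) force
    moreover have "x * (real p - real t) * ((p choose t) * x ^ t) \<le> x * (real p - real t) * k t L"
      using Suc assms(2) by (intro mult_left_mono) auto
    moreover have "x * (real p - real t) * ((p choose t) * x ^ t) = real (Suc t) * ((p choose Suc t) * x ^ Suc t)"
      using Suc.prems by (subst binomial_Suc_real) auto
    ultimately have "real (Suc t) * ((p choose Suc t) * x ^ Suc t) \<le> real (Suc t) * k (Suc t) L" by linarith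
    then show ?case by (simp only: mult_le_cancel_left_pos of_nat_0_less_iff zero_less_Suc)
  qed simp
  from this[of p] have "x ^ p \<le> k p L" by simp
  then have "z * x ^ p \<le> z * k p L" using assms(3) by (intro mult_left_mono)
  also have "\<dots> \<le> real (Suc p) * k (Suc p) L"
    unfolding of_nat_mult[symmetric] using ext[of p] by (intro clq_extension_bound[OF L]) simp
  finally show ?thesis .
qed

lemma clq_subset_eq:
  assumes "K \<in> clq t W" "A \<subseteq> K"
  shows "clq u A = {e. e \<subseteq> A \<and> card e = u}"
proof (intro set_eqI iffI)
  fix e assume "e \<in> {e. e \<subseteq> A \<and> card e = u}"
  then have "e \<subseteq> A" "e \<in> clq u W" using clq_subset[OF assms(1), of e] assms(2) by auto
  then show "e \<in> clq u A" by (simp add: clq_iff)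
qed (simp add: clq_iff)

text \<open>A vertex with D neighbours in \<open>K\<close> contributes D to the degrees and D choose
  2 to the codegrees. The linear lower bound is the chord through D = r - 1 and D = r: degrees near
  (1 - 1/r)m make the average of D about r - 1/r.\<close>

lemma sum_codegree:
  assumes W: "finite W" and K: "K \<in> clq (Suc r) W"
  shows "(\<Sum>e\<in>clq 2 K. real (card (common_nbrs W e)))
    \<ge> (real r - 1) * (\<Sum>a\<in>K. real (card (common_nbrs W {a}))) - real r * (real r - 1) / 2 * card W"
proof -
  have K': "finite K" "card K = Suc r" "K \<subseteq> W" using K by (auto simp: clq_iff)
  let ?A = "\<lambda>w. {a \<in> K. {a, w} \<in> E}"
  have deg: "(\<Sum>a\<in>K. card (common_nbrs W {a})) = (\<Sum>w\<in>W. card (?A w))"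
  proof -
    have "(\<Sum>a\<in>K. card (common_nbrs W {a})) = (\<Sum>a\<in>K. \<Sum>w\<in>W. if {a, w} \<in> E then 1 else 0)"
      using W by (intro sum.cong refl) (simp add: sum.If_cases common_nbrs_def Int_def)
    also have "\<dots> = (\<Sum>w\<in>W. \<Sum>a\<in>K. if {a, w} \<in> E then 1 else 0)" by (rule sum.swap)
    also have "\<dots> = (\<Sum>w\<in>W. card (?A w))"
      using K' by (intro sum.cong refl) (simp add: sum.If_cases Int_def)
    finally show ?thesis .
  qed
  have codeg: "(\<Sum>e\<in>clq 2 K. card (common_nbrs W e)) = (\<Sum>w\<in>W. card (?A w) choose 2)"
  proof -
    have "(\<Sum>e\<in>clq 2 K. card (common_nbrs W e)) = (\<Sum>e\<in>clq 2 K. \<Sum>w\<in>W. if w \<in> common_nbrs W e then 1 else 0)"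
      using W by (intro sum.cong refl) (simp add: sum.If_cases Int_absorb1[OF common_nbrs_subset])
    also have "\<dots> = (\<Sum>w\<in>W. \<Sum>e\<in>clq 2 K. if w \<in> common_nbrs W e then 1 else 0)" by (rule sum.swap)
    also have "\<dots> = (\<Sum>w\<in>W. card (?A w) choose 2)"
    proof (rule sum.cong[OF refl])
      fix w assume w: "w \<in> W"
      have "(\<Sum>e\<in>clq 2 K. if w \<in> common_nbrs W e then 1 else 0) = card {e \<in> clq 2 K. w \<in> common_nbrs W e}"
        using K' by (simp add: sum.If_cases Int_def)
      also have "{e \<in> clq 2 K. w \<in> common_nbrs W e} = {e. e \<subseteq> ?A w \<and> card e = 2}"
        unfolding clq_subset_eq[OF K order_refl] using w by (auto simp: common_nbrs_def)
      also have "card \<dots> = card (?A w) choose 2" using K' by (intro n_subsets) auto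
      finally show "(\<Sum>e\<in>clq 2 K. if w \<in> common_nbrs W e then 1 else 0) = card (?A w) choose 2" .
    qed
    finally show ?thesis .
  qed
  \<comment> \<open>The difference of the two sides is \<open>(D - r) * (D - r + 1) / 2\<close>, a product of consecutive integers.\<close>
  have tangent: "(real r - 1) * D - real r * (real r - 1) / 2 \<le> real (D choose 2)" for D :: nat
  proof -
    have eq: "real (D choose 2) = real D * (real D - 1) / 2"
      by (cases D) (simp_all add: choose_two field_simps real_of_nat_div)
    have "(0::int) \<le> (int D - int r) * (int D - int r + 1)"
      by (cases "D < r") (auto intro: mult_nonpos_nonpos)
    then have "0 \<le> real_of_int ((int D - int r) * (int D - int r + 1))" by (simp only: of_int_0_le_iff)
    then have "0 \<le> (real D - real r) * (real D - real r + 1)" by simp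
    then show ?thesis unfolding eq by (simp add: algebra_simps diff_divide_distrib)
  qed
  have "(real r - 1) * (\<Sum>a\<in>K. real (card (common_nbrs W {a}))) - real r * (real r - 1) / 2 * card W
      = (\<Sum>w\<in>W. (real r - 1) * card (?A w) - real r * (real r - 1) / 2)"
    using arg_cong[OF deg, of real] by (simp add: sum_subtractf sum_distrib_left)
  also have "\<dots> \<le> (\<Sum>w\<in>W. real (card (?A w) choose 2))" by (intro sum_mono tangent)
  also have "\<dots> = (\<Sum>e\<in>clq 2 K. real (card (common_nbrs W e)))"
    using arg_cong[OF codeg, of real] by simp
  finally show ?thesis .
qed

text \<open>Averaging over the r(r+1)/2 pairs of \<open>K\<close>, with that number multiplied
  out.\<close>

lemma ex_edge_large_codegree:
  fixes \<delta> :: real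
  assumes W: "finite W" and r: "2 \<le> r" and K: "K \<in> clq (Suc r) W"
    and deg: "\<And>v. v \<in> W \<Longrightarrow> \<delta> \<le> card (common_nbrs W {v})"
  shows "\<exists>e\<in>clq 2 W. (real r - 1) * (real r + 1) * \<delta> - real r * (real r - 1) / 2 * card W
      \<le> real r * (real r + 1) / 2 * card (common_nbrs W e)"
proof (rule ccontr)
  assume neg: "\<not> ?thesis"
  have K': "finite K" "card K = Suc r" "K \<subseteq> W" using K by (auto simp: clq_iff)
  let ?S = "(real r - 1) * (real r + 1) * \<delta> - real r * (real r - 1) / 2 * card W"
  have cK: "card (clq 2 K) = Suc r choose 2"
    unfolding clq_subset_eq[OF K order_refl] using K' by (subst n_subsets) auto
  have cr: "real (card (clq 2 K)) = real r * (real r + 1) / 2"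
    unfolding cK by (simp add: choose_two real_of_nat_div algebra_simps)
  have "0 < real (card (clq 2 K))" unfolding cr using r by simp
  then have ne: "finite (clq 2 K)" "clq 2 K \<noteq> {}" using K'(1) by (auto simp del: of_nat_0_less_iff)
  have "real (card (clq 2 K)) * (\<Sum>e\<in>clq 2 K. real (card (common_nbrs W e)))
      = (\<Sum>e\<in>clq 2 K. real (card (clq 2 K)) * card (common_nbrs W e))" by (simp add: sum_distrib_left)
  also have "\<dots> < (\<Sum>e\<in>clq 2 K. ?S)"
  proof (rule sum_strict_mono[OF ne])
    fix e assume "e \<in> clq 2 K"
    then have "e \<in> clq 2 W" using clq_mono[OF K'(3)] by blast
    with neg show "real (card (clq 2 K)) * card (common_nbrs W e) < ?S" unfolding cr by force
  qed
  also have "\<dots> = real (card (clq 2 K)) * ?S" by simp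
  finally have "(\<Sum>e\<in>clq 2 K. real (card (common_nbrs W e))) < ?S"
    using \<open>0 < real (card (clq 2 K))\<close> by (simp only: mult_less_cancel_left_pos)
  moreover have "(\<Sum>a\<in>K. \<delta>) \<le> (\<Sum>a\<in>K. real (card (common_nbrs W {a})))"
    using K' deg by (intro sum_mono) auto
  then have "(real r + 1) * \<delta> \<le> (\<Sum>a\<in>K. real (card (common_nbrs W {a})))" using K' by (simp add: add.commute)
  then have "(real r - 1) * ((real r + 1) * \<delta>) \<le> (real r - 1) * (\<Sum>a\<in>K. real (card (common_nbrs W {a})))"
    using r by (intro mult_left_mono) auto
  ultimately show False using sum_codegree[OF W K] by (simp only: mult.assoc)
qed

end

text \<open>Without deficit the average codegree is (r - 2)m/r plus a surplus of 2m/(r^2(r+1)). The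
  deficit 1/r^4 costs at most half of the surplus, because (r - 1)r^2(r + 1) \<le> r^4; the other
  half is the reserve for the last greedy step.\<close>

lemma codegree_arith:
  fixes r t m c :: real
  assumes r: "2 \<le> r" and t: "0 \<le> t" "t \<le> r - 2" and m: "0 \<le> m"
    and c: "(r - 1) * (r + 1) * ((1 - 1 / r) * (1 - 1 / r ^ 4) * m) - r * (r - 1) / 2 * m \<le> r * (r + 1) / 2 * c"
  shows "m / r * (r - 2 - t) + m / (r\<^sup>2 * (r + 1)) \<le> c - t * (m - (1 - 1 / r) * (1 - 1 / r ^ 4) * m)"
proof -
  define y where "y = 1 / r ^ 4"
  have y0: "0 \<le> y" using r by (simp add: y_def)
  have y: "y * (r - 1) \<le> 1 / (r\<^sup>2 * (r + 1))"
  proof -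
    have "(r - 1) * (r\<^sup>2 * (r + 1)) \<le> r ^ 4"
      by (simp add: algebra_simps power2_eq_square power4_eq_xxxx)
    then have "y * (r - 1) * (r\<^sup>2 * (r + 1)) \<le> 1" using r by (simp add: y_def divide_le_eq_1)
    then show ?thesis using r by (simp add: pos_le_divide_eq)
  qed
  have "2 / (r * (r + 1)) * ((r - 1) * (r + 1) * ((1 - 1 / r) * (1 - y) * m) - r * (r - 1) / 2 * m)
      \<le> 2 / (r * (r + 1)) * (r * (r + 1) / 2 * c)"
    using c r unfolding y_def by (intro mult_left_mono) auto
  also have "\<dots> = c" using r by simp
  finally have c': "2 / (r * (r + 1)) * ((r - 1) * (r + 1) * ((1 - 1 / r) * (1 - y) * m) - r * (r - 1) / 2 * m) \<le> c" .
  have eq: "2 / (r * (r + 1)) * ((r - 1) * (r + 1) * ((1 - 1 / r) * (1 - y) * m) - r * (r - 1) / 2 * m)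
      - t * (m - (1 - 1 / r) * (1 - y) * m)
    = m * ((r - 2 - t) / r + 2 / (r\<^sup>2 * (r + 1)) - y * (2 * ((r - 1) / r)\<^sup>2 + t * ((r - 1) / r)))"
    using r by (simp add: divide_simps) (simp add: algebra_simps power2_eq_square)
  have "2 * ((r - 1) / r)\<^sup>2 + t * ((r - 1) / r) \<le> 2 * ((r - 1) / r) + (r - 2) * ((r - 1) / r)"
  proof (intro add_mono mult_right_mono mult_left_mono)
    have "((r - 1) / r)\<^sup>2 = ((r - 1) / r) * ((r - 1) / r)" by (simp add: power2_eq_square)
    also have "\<dots> \<le> 1 * ((r - 1) / r)" using r by (intro mult_right_mono) auto
    finally show "((r - 1) / r)\<^sup>2 \<le> (r - 1) / r" by simp
  qed (use r t in auto)
  also have "\<dots> = r - 1" using r by (simp add: field_simps)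
  finally have "y * (2 * ((r - 1) / r)\<^sup>2 + t * ((r - 1) / r)) \<le> y * (r - 1)"
    using y0 by (rule mult_left_mono)
  with y have "(r - 2 - t) / r + 1 / (r\<^sup>2 * (r + 1))
      \<le> (r - 2 - t) / r + 2 / (r\<^sup>2 * (r + 1)) - y * (2 * ((r - 1) / r)\<^sup>2 + t * ((r - 1) / r))"
    by (simp add: add_divide_distrib[symmetric])
  then have "m * ((r - 2 - t) / r + 1 / (r\<^sup>2 * (r + 1)))
      \<le> m * ((r - 2 - t) / r + 2 / (r\<^sup>2 * (r + 1)) - y * (2 * ((r - 1) / r)\<^sup>2 + t * ((r - 1) / r)))"
    using m by (rule mult_left_mono)
  then show ?thesis using c' eq unfolding y_def by (simp add: distrib_left)
qed

context loopless
begin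

lemma min_degree_joint:
  assumes W: "finite W" and r: "2 \<le> r" and K: "K \<in> clq (Suc r) W"
    and deg: "\<And>v. v \<in> W \<Longrightarrow> (1 - 1 / r) * (1 - 1 / real r ^ 4) * card W \<le> card (common_nbrs W {v})"
  shows "\<exists>e\<in>clq 2 W. card W / (real r ^ 2 * (real r + 1)) * (card W / r) ^ (r - 2) \<le> (real r - 1) * k (r - 1) (common_nbrs W e)"
proof -
  let ?\<delta> = "(1 - 1 / r) * (1 - 1 / real r ^ 4) * card W"
  obtain e where e: "e \<in> clq 2 W"
    and c: "(real r - 1) * (real r + 1) * ?\<delta> - real r * (real r - 1) / 2 * card W
      \<le> real r * (real r + 1) / 2 * card (common_nbrs W e)"
    using ex_edge_large_codegree[OF W r K deg] by blast
  let ?L = "common_nbrs W e"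
  have L: "finite ?L" "?L \<subseteq> W" using W common_nbrs_subset by auto
  \<comment> \<open>Greedy extension with p = r - 2, step m/r and the reserve of
    \<open>codegree_arith\<close>; for r = 2 the reserve alone counts.\<close>
  have "card W / (real r ^ 2 * (real r + 1)) * (card W / r) ^ (r - 2) \<le> real (Suc (r - 2)) * k (Suc (r - 2)) ?L"
  proof (rule greedy_cliques[OF L(1)])
    fix t T assume t: "t \<le> r - 2" "T \<in> clq t ?L"
    then have T: "finite T" "card T = t" "T \<subseteq> W" using L by (auto simp: clq_iff)
    have "card W / r * (real r - 2 - real t) + card W / (real r ^ 2 * (real r + 1))
        \<le> card ?L - t * (card W - ?\<delta>)"
      using r t c by (intro codegree_arith) auto
    also have "\<dots> \<le> card (common_nbrs ?L T)"
      unfolding T(2)[symmetric]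
    proof (rule card_common_nbrs_ge[OF W L(2) T(1)])
      fix a assume "a \<in> T"
      with T deg[of a] show "real (card W) \<le> card (common_nbrs W {a}) + (card W - ?\<delta>)" by auto
    qed
    finally show "card W / r * (real (r - 2) - real t) + card W / (real r ^ 2 * (real r + 1)) \<le> card (common_nbrs ?L T)"
      using r by (simp add: of_nat_diff)
  qed auto
  moreover have "Suc (r - 2) = r - 1" "real (r - 1) = real r - 1" using r by (auto simp: of_nat_diff)
  ultimately show ?thesis using e by metis
qed

end

section \<open>Deleting vertices of small degree\<close>

text \<open>Once (1 - a)^p is factored out, 2a remains, and Bernoulli keeps that power above 1/2. In
  use, 1 - a stands for a rounded Turan link and 1 - 3a for the link of a low-degree vertex.\<close>

lemma power_gap:
  fixes a :: real
  assumes "0 \<le> a" "p * a \<le> 1 / 2" "3 * a \<le> 1"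
  shows "a \<le> (1 - a) ^ Suc p - (1 - 3 * a) ^ Suc p"
proof -
  have "1 / 2 \<le> 1 + real p * (- a)" using assms by simp
  also have "\<dots> \<le> (1 + (- a)) ^ p" using assms by (intro Bernoulli_inequality) simp
  finally have half: "1 / 2 \<le> (1 - a) ^ p" by simp
  have "(1 - 3 * a) ^ Suc p \<le> (1 - 3 * a) * (1 - a) ^ p"
    using assms by (auto intro!: mult_left_mono power_mono)
  moreover have "(1 - a) ^ Suc p = (1 - 3 * a) * (1 - a) ^ p + 2 * a * (1 - a) ^ p"
    by (simp add: algebra_simps)
  moreover have "2 * a * (1 / 2) \<le> 2 * a * (1 - a) ^ p"
    using assms half by (intro mult_left_mono) auto
  ultimately show ?thesis by simp
qed

text \<open>The power 4^p pays for the 2^p lost between n and m; for p = r - 1 the exponent is r +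
  6. The constant 4096 = 4^6 stays below the available 4^7.\<close>

lemma joint_constant_bound:
  fixes n m r p :: nat
  assumes "n \<le> 2 * m" "0 < r"
  shows "real n ^ p / (4 * real r) ^ (p + 7) \<le> (m / r) ^ p / (4096 * real r ^ 7)"
proof -
  have "real n ^ p \<le> (2 * real m) ^ p" using assms by (intro power_mono) linarith+
  moreover have "2 ^ p * (real r ^ p * (4096 * real r ^ 7)) \<le> (4 * real r) ^ (p + 7)"
  proof -
    have "(2::real) ^ p * 4096 \<le> 4 ^ p * 4 ^ 7" by (intro mult_mono power_mono) auto
    then have "(2 ^ p * 4096) * (real r ^ p * real r ^ 7) \<le> (4 ^ p * 4 ^ 7) * (real r ^ p * real r ^ 7)"
      by (rule mult_right_mono) simp
    then show ?thesis by (simp add: power_mult_distrib power_add mult_ac)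
  qed
  ultimately have "real n ^ p / (4 * real r) ^ (p + 7) \<le> (2 * real m) ^ p / (2 ^ p * (real r ^ p * (4096 * real r ^ 7)))"
    using assms by (intro frac_le) auto
  also have "\<dots> = (m / r) ^ p / (4096 * real r ^ 7)"
    by (simp add: power_mult_distrib power_divide)
  finally show ?thesis .
qed

text \<open>Each class of the link has at least \<open>m div r\<close> vertices, which falls short
  of Suc m / r by at most one; for Suc m \<ge> 4r^5 that is at most a fraction 1/(4r^4) of
  it.\<close>

lemma turan_num_drop:
  assumes r: "2 \<le> r" and m: "4 * real r ^ 5 \<le> Suc m"
  shows "(r - 1 choose t) * (Suc m / r * (1 - 1 / (4 * real r ^ 4))) ^ t \<le> turan_num (r - 1) (m - m div r) t"
proof -
  have "m div r \<le> (m - m div r) div (r - 1)"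
  proof -
    have "m div r * (r - 1) \<le> m - m div r"
      unfolding diff_mult_distrib2 mult_1_right by (intro diff_le_mono div_times_less_eq_dividend)
    then show ?thesis using r by (simp add: less_eq_div_iff_mult_less_eq)
  qed
  moreover have "Suc m / r * (1 - 1 / (4 * real r ^ 4)) \<le> m div r"
  proof -
    have "Suc m \<le> r * (m div r) + r" using dividend_less_times_div[of r m] r by simp
    then have "real (Suc m) \<le> real r * real (m div r) + r" by (metis of_nat_add of_nat_le_iff of_nat_mult)
    then have "Suc m / r \<le> real (m div r) + 1" using r by (simp add: field_simps)
    moreover have "1 \<le> Suc m / r * (1 / (4 * real r ^ 4))"
    proof -
      have "real r * (4 * real r ^ 4) = 4 * real r ^ 5" by (simp add: eval_nat_numeral)
      then show ?thesis using m r by (simp add: le_divide_eq)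
    qed
    ultimately show ?thesis by (simp add: right_diff_distrib)
  qed
  ultimately have "Suc m / r * (1 - 1 / (4 * real r ^ 4)) \<le> (m - m div r) div (r - 1)" by linarith
  moreover have "0 \<le> Suc m / r * (1 - 1 / (4 * real r ^ 4))"
  proof -
    have "1 \<le> real r ^ 4" using r by simp
    then show ?thesis by (intro mult_nonneg_nonneg) (auto simp: divide_le_eq)
  qed
  ultimately have "(r - 1 choose t) * (Suc m / r * (1 - 1 / (4 * real r ^ 4))) ^ t
      \<le> (r - 1 choose t) * real ((m - m div r) div (r - 1)) ^ t"
    by (intro mult_left_mono power_mono) auto
  also have "\<dots> \<le> turan_num (r - 1) (m - m div r) t" using r by (intro turan_num_ge) simp
  finally show ?thesis .
qed

section \<open>Clique counts in links and in the final subgraph\<close>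

context loopless
begin

text \<open>Moon-Moser with r - 1 parts: the bound on the order of \<open>N\<close> carries the
  factor 1 - y, and the few r-cliques give back at most a quarter of y per factor.\<close>

lemma low_degree_link_cliques:
  fixes m :: real
  assumes N: "finite N" and r: "2 \<le> r" and t: "0 < t" "t < r" and m: "0 < m"
    and card: "card N \<le> (1 - 1 / r) * (1 - 1 / real r ^ 4) * m"
    and few: "k r N \<le> (m / r) ^ r / (4096 * real r ^ 7)"
  shows "k t N \<le> (r - 1 choose t) * (m / r * (1 - 3 / (4 * real r ^ 4))) ^ t"
proof -
  obtain R where R: "r = Suc R" using r by (cases r) auto
  have R0: "0 < real R" using r R by simp
  define y where "y = 1 / real r ^ 4"
  define x where "x = m / r * (1 - y)"
  define M where "M = real R * x"
  \<comment> \<open>Chosen so that the correction R\<open>\<theta>\<close> in each factor is at most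
    y/4.\<close>
  define \<theta> where "\<theta> = 1 / (4 * real r ^ 5)"
  have r4: "16 \<le> real r ^ 4" using power_mono[of 2 "real r" 4] r by simp
  have y: "0 < y" "y \<le> 1 / 16" using r4 r by (auto simp: y_def field_simps)
  have x0: "0 < x" using m r y by (simp add: x_def)
  have th0: "0 < \<theta>" using r by (simp add: \<theta>_def)
  have MR: "M / R = x" using R0 by (simp add: M_def)
  have M0: "0 \<le> M" using x0 by (simp add: M_def)
  have cN: "real (card N) \<le> M"
  proof -
    have "(1 - 1 / r) * (1 - 1 / real r ^ 4) * m = M"
      using r unfolding M_def x_def y_def by (simp add: R field_simps)
    with card show ?thesis by simp
  qed
  \<comment> \<open>The permitted number of r-cliques has to fit under the bound at order R + 1;
    passing from m/r to x costs (1 - y)^r, which is at least 1/2.\<close>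
  have top: "k (Suc R) N \<le> mm_bound R M (\<theta> * M / R) (Suc R)"
  proof -
    have bern: "1 / 2 \<le> (1 - y) ^ r"
    proof -
      have "real r * y = 1 / real r ^ 3" using r by (simp add: y_def eval_nat_numeral)
      also have "\<dots> \<le> 1 / 2" using power_mono[of 2 "real r" 3] r by (simp add: field_simps)
      finally have "1 / 2 \<le> 1 + real r * (- y)" by simp
      also have "\<dots> \<le> (1 + (- y)) ^ r" using y by (intro Bernoulli_inequality) simp
      finally show ?thesis by simp
    qed
    have "k (Suc R) N \<le> (m / r) ^ r / (4096 * real r ^ 7)" using few R by simp
    also have "\<dots> \<le> (m / r) ^ r / (16 * real r ^ 5)"
    proof -
      have "real r ^ 5 \<le> real r ^ 7" using r by (intro power_increasing) auto
      then have "16 * real r ^ 5 \<le> 4096 * real r ^ 7" by (intro mult_mono) auto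
      then show ?thesis using r m by (intro divide_left_mono) auto
    qed
    also have "\<dots> = (m / r) ^ r * (1 / 2) * (\<theta> * (1 / 2))" by (simp add: \<theta>_def)
    also have "\<dots> \<le> (m / r) ^ r * (1 - y) ^ r * (\<theta> * (R / r))"
      using bern r m th0 R by (intro mult_mono) (auto simp: field_simps)
    also have "\<dots> = x ^ r * (\<theta> * (R / r))" by (simp only: x_def power_mult_distrib)
    also have "\<dots> = x ^ R * (R * (\<theta> * x)) / r" by (simp add: R mult_ac)
    also have "\<dots> \<le> mm_bound R M (\<theta> * M / R) R * (R * (\<theta> * x)) / r"
      using mm_bound_ge[OF M0, of "\<theta> * M / R" R R] th0 x0 M0 MR
      by (intro divide_right_mono mult_right_mono) auto
    also have "\<dots> = mm_bound R M (\<theta> * M / R) (Suc R)"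
      using R MR by (simp add: times_divide_eq_right[symmetric] del: times_divide_eq_right)
    finally show ?thesis .
  qed
  have "k t N \<le> mm_bound R M (\<theta> * M / R) t"
    by (rule k_le_mm_bound[OF N cN _ _ _ top]) (use t R M0 th0 in auto)
  also have "\<dots> \<le> (R choose t) * (M / R * (1 + R * \<theta>)) ^ t"
    using t R M0 th0 by (intro mm_bound_le) auto
  also have "\<dots> \<le> (R choose t) * (m / r * (1 - 3 * y / 4)) ^ t"
  proof (intro mult_left_mono power_mono)
    have "R * \<theta> \<le> r * \<theta>" using th0 R by (intro mult_right_mono) auto
    also have "\<dots> = y / 4" using r by (simp add: \<theta>_def y_def eval_nat_numeral)
    finally have "(1 - y) * (1 + R * \<theta>) \<le> (1 - y) * (1 + y / 4)" using y by (intro mult_left_mono) auto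
    also have "\<dots> \<le> 1 - 3 * y / 4" using y by (simp add: algebra_simps)
    finally have "m / r * ((1 - y) * (1 + R * \<theta>)) \<le> m / r * (1 - 3 * y / 4)"
      using m by (intro mult_left_mono) auto
    then show "M / R * (1 + R * \<theta>) \<le> m / r * (1 - 3 * y / 4)"
      unfolding MR by (simp add: x_def mult.assoc)
    show "0 \<le> M / R * (1 + R * \<theta>)" using MR x0 th0 by simp
  qed simp
  also have "\<dots> = (r - 1 choose t) * (m / r * (1 - 3 / (4 * real r ^ 4))) ^ t"
    by (simp add: R y_def mult.commute)
  finally show ?thesis .
qed

text \<open>The permitted excess s/(8r^4) is matched to the surplus that rq/2 deletions accumulate.
  Each factor errs by 1 + y, in total at most 1 + 2sy, below the target 1 + 4sy.\<close>

lemma few_cliques_upper_bound: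
  assumes W: "finite W" "card W = r * q" and r: "2 \<le> r" and s: "0 < s" "s \<le> r" and q: "0 < q"
    and few: "real (Suc r) * k (Suc r) W \<le> real q ^ Suc r / (4096 * real r ^ 6)"
  shows "k s W < (r choose s) * real q ^ s * (1 + s / (8 * real r ^ 4))"
proof -
  define \<theta> where "\<theta> = 1 / (32 * real r ^ 5)"
  define y where "y = 1 / (32 * real r ^ 4)"
  define M where "M = real r * q"
  have th0: "0 < \<theta>" using r by (simp add: \<theta>_def)
  have y0: "0 < y" using r by (simp add: y_def)
  have ry: "r * \<theta> = y" using r by (simp add: \<theta>_def y_def eval_nat_numeral)
  have Mr: "M / r = q" using r by (simp add: M_def)
  have M0: "0 \<le> M" by (simp add: M_def)
  have top: "k (Suc r) W \<le> mm_bound r M (\<theta> * M / r) (Suc r)"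
  proof -
    have "real (Suc r) * k (Suc r) W \<le> real q ^ Suc r * (1 / (4096 * real r ^ 6))" using few by simp
    also have "\<dots> \<le> real q ^ Suc r * y"
    proof -
      have "real r ^ 4 \<le> real r ^ 6" using r by (intro power_increasing) auto
      then have "32 * real r ^ 4 \<le> 4096 * real r ^ 6" by (intro mult_mono) auto
      then have "1 / (4096 * real r ^ 6) \<le> y" unfolding y_def using r by (intro divide_left_mono) auto
      then show ?thesis by (intro mult_left_mono) auto
    qed
    also have "\<dots> = (M / r) ^ r * (r * (\<theta> * M / r))"
    proof -
      have "r * (\<theta> * M / r) = (r * \<theta>) * (M / r)" by simp
      then show ?thesis unfolding ry Mr by simp
    qed
    also have "\<dots> \<le> mm_bound r M (\<theta> * M / r) r * (r * (\<theta> * M / r))"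
      using mm_bound_ge[OF M0, of "\<theta> * M / r" r r] th0 M0 by (intro mult_right_mono) auto
    also have "\<dots> = real (Suc r) * mm_bound r M (\<theta> * M / r) (Suc r)" by simp
    finally show ?thesis by (simp only: mult_le_cancel_left_pos of_nat_0_less_iff zero_less_Suc)
  qed
  have "k s W \<le> mm_bound r M (\<theta> * M / r) s"
    by (rule k_le_mm_bound[OF W(1) _ _ _ _ top]) (use W s M0 th0 in \<open>auto simp: M_def\<close>)
  also have "\<dots> \<le> (r choose s) * (M / r * (1 + r * \<theta>)) ^ s"
    using s M0 th0 by (intro mm_bound_le) auto
  also have "\<dots> = (r choose s) * real q ^ s * (1 + y) ^ s" by (simp add: Mr ry power_mult_distrib)
  also have "\<dots> < (r choose s) * real q ^ s * (1 + s / (8 * real r ^ 4))"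
  proof (rule mult_strict_left_mono)
    have sy: "s * y \<le> 1 / 2"
    proof -
      have "s * y \<le> r * y" using s y0 by (intro mult_right_mono) auto
      also have "\<dots> = 1 / (32 * real r ^ 3)" using r by (simp add: y_def eval_nat_numeral)
      also have "\<dots> \<le> 1 / 2" using power_mono[of 2 "real r" 3] r by (simp add: field_simps)
      finally show ?thesis .
    qed
    have "(1 + y) ^ s \<le> exp y ^ s" using y0 exp_ge_add_one_self[of y] by (intro power_mono) auto
    also have "\<dots> = exp (s * y)" by (simp add: exp_of_nat_mult)
    also have "\<dots> \<le> 1 + 2 * (s * y)"
      using exp_bound_lemma[of "real s * y"] sy y0 by simp
    also have "\<dots> < 1 + 4 * (s * y)" using s y0 by simp
    also have "\<dots> = 1 + s / (8 * real r ^ 4)" by (simp add: y_def)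
    finally show "(1 + y) ^ s < 1 + s / (8 * real r ^ 4)" .
    show "0 < real (r choose s) * real q ^ s" using s q by simp
  qed
  finally show ?thesis .
qed


text \<open>Each clique of the link is counted through its vertices u, and those at u belong to the
  joint at the edge vu. The bound \<open>J\<close> refers to all of \<open>V\<close>, so it survives
  every deletion.\<close>

lemma link_cliques_le:
  fixes J :: real
  assumes V: "finite V" "W \<subseteq> V" and v: "v \<in> W"
    and J: "\<And>e. e \<in> clq 2 V \<Longrightarrow> k t (common_nbrs V e) \<le> J"
  shows "Suc t * k (Suc t) (common_nbrs W {v}) \<le> J * card (common_nbrs W {v})"
proof -
  have W: "finite W" using V finite_subset by blast
  have "real (Suc t * k (Suc t) (common_nbrs W {v})) = (\<Sum>u\<in>common_nbrs W {v}. real (k t (common_nbrs (common_nbrs W {v}) {u})))"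
    unfolding of_nat_sum[symmetric] using sum_k_common_nbrs[of "common_nbrs W {v}" t] W by simp
  also have "\<dots> \<le> (\<Sum>u\<in>common_nbrs W {v}. J)"
  proof (rule sum_mono)
    fix u assume u: "u \<in> common_nbrs W {v}"
    then have "v \<noteq> u" using no_loop by (auto simp: common_nbrs_def)
    then have "{v, u} \<in> clq 2 V" using u v V by (auto simp: clq_iff common_nbrs_def insert_commute)
    then have "k t (common_nbrs V {v, u}) \<le> J" by (rule J)
    moreover have "k t (common_nbrs W {v, u}) \<le> k t (common_nbrs V {v, u})" using V by (intro k_mono common_nbrs_mono) auto
    ultimately show "real (k t (common_nbrs (common_nbrs W {v}) {u})) \<le> J" by (simp add: common_nbrs_common_nbrs insert_commute)
  qed
  finally show ?thesis by (simp add: mult.commute)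
qed

theorem joints_extremal:
  fixes J :: real
  assumes V: "finite V" and n: "r ^ 8 < card V" and s: "2 \<le> s" "s \<le> r"
    and J: "\<And>e. e \<in> clq 2 V \<Longrightarrow> k (r - 1) (common_nbrs V e) \<le> J"
    and J0: "0 \<le> J" and J_le: "J \<le> real (card V) ^ (r - 1) / (4 * real r) ^ (r + 6)"
    and many: "turan_num r (card V) s \<le> k s V"
  shows "\<exists>c. turan_colouring {..<r} c V"
proof -
  define n where "n = card V"
  \<comment> \<open>Stopping at a multiple of \<open>r\<close> makes \<open>turan_num r (r * q) s = (r choose s) * q ^ s\<close>, free of rounding.\<close>
  define q where "q = n div (2 * r) + 1"
  \<comment> \<open>The guaranteed gain of one deletion, written with \<open>q\<close> instead of
    m/r so that it is the same at every stage m \<ge> rq.\<close>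
  define g where "g = (r - 1 choose (s - 1)) * real q ^ (s - 1) * (1 / (4 * real r ^ 4))"
  \<comment> \<open>The surplus over the Turan number is at least \<open>g\<close> for each vertex
    deleted so far.\<close>
  define Inv where "Inv W \<longleftrightarrow> W \<subseteq> V \<and> r * q \<le> card W \<and>
      turan_num r (card W) s + (real n - card W) * g \<le> k s W" for W
  have r: "2 \<le> r" using s by simp
  have r7: "128 \<le> r ^ 7" using power_mono[of 2 r 7] r by simp
  have n8: "r ^ 7 * r < n" using n by (simp add: n_def eval_nat_numeral)
  have n128: "128 * r < n" using r7 n8 by (meson le_less_trans mult_le_mono1)
  have q0: "0 < q" by (simp add: q_def)
  have g0: "0 \<le> g" by (simp add: g_def)
  have rq2: "n \<le> 2 * (r * q)"
    using dividend_less_times_div[of "2 * r" n] r by (simp add: q_def algebra_simps)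
  have "2 * r * (n div (2 * r)) \<le> n" by (rule times_div_less_eq_dividend)
  then have rq3: "2 * (r * q) \<le> n + 2 * r" by (simp add: q_def algebra_simps)
  \<comment> \<open>Equivalently n - rq \<ge> rq/2, the number of deletions available before order
    rq is reached.\<close>
  have rqn: "3 * (r * q) \<le> 2 * n" using rq3 n128 by linarith
  have n5: "8 * r ^ 5 \<le> n"
  proof -
    have "8 * r ^ 5 = 2 ^ 3 * r ^ 5" by simp
    also have "\<dots> \<le> r ^ 3 * r ^ 5" using r by (intro mult_right_mono power_mono) auto
    also have "\<dots> = r ^ 7 * r" by (simp add: eval_nat_numeral)
    finally show ?thesis using n8 by simp
  qed
  have J_small: "J \<le> (real m / r) ^ (r - 1) / (4096 * real r ^ 7)" if "r * q \<le> m" for m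
  proof -
    have "n \<le> 2 * m" using rq2 that by linarith
    from joint_constant_bound[OF this, of r "r - 1"] r
    have "real n ^ (r - 1) / (4 * real r) ^ (r - 1 + 7) \<le> (real m / r) ^ (r - 1) / (4096 * real r ^ 7)" by simp
    moreover have "r - 1 + 7 = r + 6" using r by simp
    ultimately have "real n ^ (r - 1) / (4 * real r) ^ (r + 6) \<le> (real m / r) ^ (r - 1) / (4096 * real r ^ 7)"
      by (simp only:)
    with J_le[folded n_def] show ?thesis by (rule order_trans)
  qed
  have link_few: "real r * k r (common_nbrs W {v}) \<le> J * card (common_nbrs W {v})" if "W \<subseteq> V" "v \<in> W" for W v
  proof -
    have "real (Suc (r - 1) * k (Suc (r - 1)) (common_nbrs W {v})) \<le> J * card (common_nbrs W {v})"
      using V that J by (rule link_cliques_le)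
    moreover have "Suc (r - 1) = r" using r by simp
    ultimately show ?thesis by simp
  qed
  have "Inv V" using many rqn by (simp add: Inv_def n_def)
  \<comment> \<open>A set of least order satisfying \<open>Inv\<close> replaces an explicit deletion
    sequence: it either has order rq or admits no further deletion.\<close>
  then obtain W where W: "Inv W" and least: "\<And>W'. Inv W' \<Longrightarrow> card W \<le> card W'"
    using ex_has_least_nat[of Inv V card] by blast
  define m where "m = card W"
  have WV: "W \<subseteq> V" and mq: "r * q \<le> m" and kW: "turan_num r m s + (real n - m) * g \<le> k s W"
    using W by (auto simp: Inv_def m_def)
  have finW: "finite W" using V WV finite_subset by blast
  have mn: "m \<le> n" using V WV by (simp add: card_mono m_def n_def)
  have m5: "4 * real r ^ 5 \<le> m"
  proof -
    have "4 * r ^ 5 \<le> m" using n5 rq2 mq by linarith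
    then have "real (4 * r ^ 5) \<le> real m" by (simp only: of_nat_le_iff)
    then show ?thesis by simp
  qed
  have m0: "0 < m" using mq q0 r by (metis less_le_trans nat_0_less_mult_iff less_le_trans pos2)
  show ?thesis
  proof (cases "m = r * q")
    case True
    have "real (Suc r) * k (Suc r) W = (\<Sum>v\<in>W. real (k r (common_nbrs W {v})))"
      using arg_cong[OF sum_k_common_nbrs[OF finW, of r], of real] by (simp add: algebra_simps)
    also have "\<dots> \<le> (\<Sum>v\<in>W. J * m / r)"
    proof (rule sum_mono)
      fix v assume v: "v \<in> W"
      have "real r * k r (common_nbrs W {v}) \<le> J * card (common_nbrs W {v})" using link_few WV v .
      also have "\<dots> \<le> J * m"
        using finW J0 by (intro mult_left_mono) (simp_all add: m_def card_mono common_nbrs_subset)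
      finally show "k r (common_nbrs W {v}) \<le> J * m / r" using r by (simp add: field_simps)
    qed
    also have "\<dots> = J * (real m * m / r)" by (simp add: m_def)
    also have "\<dots> \<le> (real m / r) ^ (r - 1) / (4096 * real r ^ 7) * (real m * m / r)"
      using J_small[OF mq] by (intro mult_right_mono) auto
    also have "\<dots> = real q ^ Suc r / (4096 * real r ^ 6)"
    proof -
      obtain p where p: "r = Suc p" using r by (cases r) auto
      have mr: "real m / r = q" using r by (simp add: True)
      have "real m * m / r = real r * (real q * q)" using r by (simp add: True)
      then show ?thesis unfolding mr using r by (simp add: p eval_nat_numeral)
    qed
    finally have "k s W < (r choose s) * real q ^ s * (1 + s / (8 * real r ^ 4))"
      using finW r s q0 True by (intro few_cliques_upper_bound) (auto simp: m_def)
    also have "\<dots> = (r choose s) * real q ^ s + real s * (r choose s) * real q ^ s / (8 * real r ^ 4)"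
      by (simp add: algebra_simps)
    \<comment> \<open>By s (r choose s) = r (r-1 choose s-1), the left side is exactly rq/2 times
      \<open>g\<close>, so the accumulated surplus covers it.\<close>
    also have "real s * (r choose s) * real q ^ s / (8 * real r ^ 4) \<le> (real n - m) * g"
    proof -
      obtain s' r' where sr: "s = Suc s'" "r = Suc r'" using s r by (cases s; cases r) auto
      have "s * (r choose s) = r * (r - 1 choose (s - 1))"
        using binomial_absorption[of s' r] by (simp only: sr diff_Suc_1)
      then have absorb: "real s * real (r choose s) = real r * real (r - 1 choose (s - 1))"
        by (simp only: of_nat_mult[symmetric])
      have "real q ^ s = q * real q ^ (s - 1)" by (simp add: sr)
      then have "real s * (r choose s) * real q ^ s / (8 * real r ^ 4) = (r * q / 2) * g"
        unfolding g_def absorb by (simp add: mult_ac)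
      also have "\<dots> \<le> (real n - m) * g"
      proof (rule mult_right_mono[OF _ g0])
        have "real (3 * (r * q)) \<le> real (2 * n)" using rqn by (simp only: of_nat_le_iff)
        then show "r * q / 2 \<le> real n - m" unfolding True by (simp add: mult.commute)
      qed
      finally show ?thesis .
    qed
    also have "(r choose s) * real q ^ s \<le> turan_num r m s"
      using turan_num_ge[of r s m] r True by simp
    finally show ?thesis using kW by simp
  next
    case False
    then have mlt: "r * q < m" using mq by simp
    have deg: "(1 - 1 / r) * (1 - 1 / real r ^ 4) * m \<le> card (common_nbrs W {v})" if v: "v \<in> W" for v
    proof (rule ccontr)
      assume low: "\<not> ?thesis"
      \<comment> \<open>A quarter of the degree deficit 1/r^4: rounding leaves the Turan link at
        least 1 - a, the few r-cliques leave the actual link at most 1 - 3a.\<close>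
      define a where "a = 1 / (4 * real r ^ 4)"
      have "real r * k r (common_nbrs W {v}) \<le> J * card (common_nbrs W {v})" using link_few WV v .
      also have "\<dots> \<le> J * m"
        using finW J0 by (intro mult_left_mono) (simp_all add: m_def card_mono common_nbrs_subset)
      also have "\<dots> \<le> (real m / r) ^ (r - 1) / (4096 * real r ^ 7) * m"
        using J_small[OF mq] by (intro mult_right_mono) auto
      also have "\<dots> = r * ((m / r) ^ r / (4096 * real r ^ 7))"
      proof -
        obtain p where p: "r = Suc p" using r by (cases r) auto
        show ?thesis by (simp add: p)
      qed
      finally have "k r (common_nbrs W {v}) \<le> (real m / r) ^ r / (4096 * real r ^ 7)"
        using r by (subst (asm) mult_le_cancel_left_pos) auto
      then have link: "k (s - 1) (common_nbrs W {v}) \<le> (r - 1 choose (s - 1)) * (m / r * (1 - 3 * a)) ^ (s - 1)"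
        using low finW r s m0 low_degree_link_cliques[of "common_nbrs W {v}" r "s - 1" "real m"]
        by (simp add: a_def)
      obtain m' where m': "m = Suc m'" using m0 by (cases m) auto
      obtain s' where s': "s = Suc (Suc s')" using s by (metis add_2_eq_Suc le_Suc_ex)
      have drop: "(r - 1 choose (s - 1)) * (m / r * (1 - a)) ^ (s - 1) \<le> turan_num (r - 1) (m' - m' div r) (s - 1)"
        using turan_num_drop[OF r, of m' "s - 1"] m5 unfolding m' a_def by simp
      have gap: "a \<le> (1 - a) ^ Suc s' - (1 - 3 * a) ^ Suc s'"
      proof (rule power_gap)
        have r4: "16 \<le> real r ^ 4" using power_mono[of 2 "real r" 4] r by simp
        show "0 \<le> a" by (simp add: a_def)
        show "3 * a \<le> 1" using r4 r by (simp add: a_def divide_le_eq)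
        have "s' * a \<le> r * a" using s s' by (intro mult_right_mono) (auto simp: a_def)
        also have "\<dots> = 1 / (4 * real r ^ 3)" using r by (simp add: a_def eval_nat_numeral)
        also have "\<dots> \<le> 1 / 2" using power_mono[of 2 "real r" 3] r by (simp add: field_simps)
        finally show "s' * a \<le> 1 / 2" .
      qed
      have "g \<le> (r - 1 choose (s - 1)) * (m / r) ^ (s - 1) * a"
        unfolding g_def a_def
      proof (intro mult_right_mono mult_left_mono power_mono)
        have "real (r * q) \<le> real m" using mq by (simp only: of_nat_le_iff)
        then show "q \<le> m / r" using r by (simp add: field_simps)
      qed auto
      also have "\<dots> \<le> (r - 1 choose (s - 1)) * (m / r) ^ (s - 1) * ((1 - a) ^ (s - 1) - (1 - 3 * a) ^ (s - 1))"
        using gap by (intro mult_left_mono) (auto simp: s')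
      also have "\<dots> = (r - 1 choose (s - 1)) * (m / r * (1 - a)) ^ (s - 1) - (r - 1 choose (s - 1)) * (m / r * (1 - 3 * a)) ^ (s - 1)"
        unfolding power_mult_distrib by (simp add: right_diff_distrib)
      also have "\<dots> \<le> real (turan_num (r - 1) (m' - m' div r) (s - 1)) - real (k (s - 1) (common_nbrs W {v}))"
        using drop link by linarith
      finally have gain: "g \<le> real (turan_num (r - 1) (m' - m' div r) (s - 1)) - real (k (s - 1) (common_nbrs W {v}))" .
      have "k s W = k s (W - {v}) + k (s - 1) (common_nbrs W {v})"
        using k_remove_vertex[OF finW v, of "s - 1"] s by simp
      moreover have "turan_num r m s = turan_num r m' s + turan_num (r - 1) (m' - m' div r) (s - 1)"
        by (simp add: m' s')
      moreover have c: "card (W - {v}) = m'" using finW v m' by (simp add: m_def)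
      moreover have "(real n - m') * g = (real n - m) * g + g" by (simp add: m' algebra_simps)
      ultimately have "turan_num r m' s + (real n - m') * g \<le> k s (W - {v})" using kW gain by linarith
      then have "Inv (W - {v})" using WV mlt m' c by (auto simp: Inv_def)
      from least[OF this] show False using c m' by (simp add: m_def)
    qed
    show ?thesis
    proof (cases "k (Suc r) W = 0")
      case True
      have "k s W \<le> turan_num r m s" using zykov[OF finW True] by (simp add: m_def)
      then have le: "(real n - m) * g \<le> 0" using kW by linarith
      have "0 < g" using q0 r s by (simp add: g_def)
      then have "m = n" using le mn by (simp add: mult_le_0_iff)
      then have WeqV: "W = V" using WV V by (simp add: card_subset_eq m_def n_def)
      show ?thesis
      proof (rule zykov_unique[OF V _ s])
        show "k (Suc r) V = 0" using True WeqV by simp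
        show "s \<le> card V" using s n128 by (simp add: n_def)
      qed (rule many)
    next
      case False
      then obtain K where "K \<in> clq (Suc r) W"
        by (metis card.empty equals0I num_cliques_def)
      from min_degree_joint[OF finW r this] deg
      obtain e where e: "e \<in> clq 2 W"
        and ge: "m / (real r ^ 2 * (real r + 1)) * (m / r) ^ (r - 2) \<le> (real r - 1) * k (r - 1) (common_nbrs W e)"
        unfolding m_def by blast
      have "real (k (r - 1) (common_nbrs W e)) \<le> k (r - 1) (common_nbrs V e)"
        using V WV by (simp add: k_mono common_nbrs_mono)
      also have "\<dots> \<le> J" using e clq_mono[OF WV] by (intro J) blast
      also have "J \<le> (real m / r) ^ (r - 1) / (4096 * real r ^ 7)" by (rule J_small[OF mq])
      finally have "(real r - 1) * k (r - 1) (common_nbrs W e) \<le> (real r - 1) * ((real m / r) ^ (r - 1) / (4096 * real r ^ 7))"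
        using r by (intro mult_left_mono) auto
      with ge have "m / (real r ^ 2 * (real r + 1)) * (m / r) ^ (r - 2) \<le> (real r - 1) * ((real m / r) ^ (r - 1) / (4096 * real r ^ 7))"
        by linarith
      \<comment> \<open>Both sides now carry (m/r)^(r-1); cancelling it leaves 4096 r^7 \<le> (r -
        1)r(r + 1), which is absurd.\<close>
      moreover have "m / (real r ^ 2 * (real r + 1)) * (m / r) ^ (r - 2) = (m / r) ^ (r - 1) * (1 / (r * (real r + 1)))"
      proof -
        obtain p where p: "r = Suc (Suc p)" using r by (metis add_2_eq_Suc le_Suc_ex)
        show ?thesis by (simp add: p power2_eq_square)
      qed
      ultimately have "(m / r) ^ (r - 1) * (1 / (r * (real r + 1))) \<le> (m / r) ^ (r - 1) * ((real r - 1) / (4096 * real r ^ 7))"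
        by (simp add: mult.commute)
      moreover have "0 < (real m / r) ^ (r - 1)" using m0 r by simp
      ultimately have "1 / (r * (real r + 1)) \<le> (real r - 1) / (4096 * real r ^ 7)"
        by (simp only: mult_le_cancel_left_pos)
      then have "1 * (4096 * real r ^ 7) \<le> (real r - 1) * (r * (real r + 1))"
        using r by (simp add: pos_divide_le_eq pos_le_divide_eq mult_ac)
      also have "\<dots> \<le> real r ^ 3" by (simp add: algebra_simps eval_nat_numeral)
      also have "\<dots> \<le> real r ^ 7" using r by (intro power_increasing) auto
      finally show ?thesis using r by simp
    qed
  qed
qed

end

section \<open>Balanced colourings and isomorphism\<close>

text \<open>With only the values q and q + 1, the sum determines how often q + 1 occurs; the larger
  and the smaller classes are matched separately.\<close>

lemma ex_bij_matching_sizes: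
  fixes a b :: "nat \<Rightarrow> nat"
  assumes "\<And>i. i < r \<Longrightarrow> q \<le> a i \<and> a i \<le> q + 1" "\<And>i. i < r \<Longrightarrow> q \<le> b i \<and> b i \<le> q + 1"
    and "(\<Sum>i<r. a i) = (\<Sum>i<r. b i)"
  shows "\<exists>p. bij_betw p {..<r} {..<r} \<and> (\<forall>i<r. a i = b (p i))"
proof -
  let ?A = "{i \<in> {..<r}. a i = q + 1}" and ?B = "{i \<in> {..<r}. b i = q + 1}"
  have sum: "(\<Sum>i<r. f i) = r * q + card {i \<in> {..<r}. f i = q + 1}"
    if "\<And>i. i < r \<Longrightarrow> q \<le> f i \<and> f i \<le> q + 1" for f :: "nat \<Rightarrow> nat"
  proof -
    have "(\<Sum>i<r. f i) = (\<Sum>i<r. q + (if f i = q + 1 then 1 else 0))"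
    proof (rule sum.cong[OF refl])
      fix i assume "i \<in> {..<r}"
      then show "f i = q + (if f i = q + 1 then 1 else 0)" using that[of i] by simp
    qed
    then show ?thesis by (simp add: sum.distrib sum.If_cases Int_def)
  qed
  have cAB: "card ?A = card ?B" using sum[of a] sum[of b] assms by simp
  then obtain f where f: "bij_betw f ?A ?B" using finite_same_card_bij[of ?A ?B] by auto
  have "card ({..<r} - ?A) = card {..<r} - card ?A" by (rule card_Diff_subset) auto
  moreover have "card ({..<r} - ?B) = card {..<r} - card ?B" by (rule card_Diff_subset) auto
  ultimately obtain h where h: "bij_betw h ({..<r} - ?A) ({..<r} - ?B)"
    using finite_same_card_bij[of "{..<r} - ?A" "{..<r} - ?B"] cAB by auto
  let ?p = "\<lambda>i. if i \<in> ?A then f i else h i"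
  have "bij_betw ?p (?A \<union> ({..<r} - ?A)) (?B \<union> ({..<r} - ?B))"
    using f h by (intro bij_betw_disjoint_Un) auto
  moreover have "?A \<union> ({..<r} - ?A) = {..<r}" "?B \<union> ({..<r} - ?B) = {..<r}" by auto
  ultimately have p: "bij_betw ?p {..<r} {..<r}" by simp
  have "a i = b (?p i)" if i: "i < r" for i
  proof (cases "i \<in> ?A")
    case True
    then have "f i \<in> ?B" using f by (rule bij_betwE[rule_format, rotated])
    with True show ?thesis by simp
  next
    case False
    then have "h i \<in> {..<r} - ?B" using h i by (intro bij_betwE[rule_format, OF h]) auto
    then have "b (h i) = q" using assms(2)[of "h i"] by auto
    moreover have "a i = q" using False i assms(1)[of i] by auto
    ultimately show ?thesis using False by (simp only: if_False)
  qed
  with p show ?thesis by blast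
qed

text \<open>Balance does not say which colours have the larger classes, so colours are first
  permuted to match sizes; classes are then mapped bijectively, and colours decide adjacency on both
  sides.\<close>

lemma turan_colouring_isomorphic:
  assumes E: "loopless E" and V: "finite V" and r: "0 < r"
    and col: "loopless.turan_colouring E {..<r} c V"
  shows "graph_isomorphic (V, E) (turan_graph r (card V))"
proof -
  interpret loopless E by (rule E)
  let ?n = "card V" and ?T = "uedges (turan_graph r (card V))"
  interpret T: loopless ?T by (rule loopless_turan)
  have colT: "T.turan_colouring {..<r} (\<lambda>i. i mod r) {..<?n}" by (rule turan_colouring_turan_graph[OF r])
  let ?a = "\<lambda>i. card {w \<in> V. c w = i}" and ?b = "\<lambda>i. card {w \<in> {..<?n}. w mod r = i}"
  have "(\<Sum>i<r. ?a i) = (\<Sum>i<r. ?b i)"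
    using sum_class_sizes[OF V turan_colouringD(1,2)[OF col]]
      T.sum_class_sizes[OF _ T.turan_colouringD(1,2)[OF colT]] by simp
  moreover have "?n div r \<le> ?a i \<and> ?a i \<le> ?n div r + 1" if "i < r" for i
    using class_size_lower[OF col V, of i] class_size_upper[OF col V, of i] that by simp
  moreover have "?n div r \<le> ?b i \<and> ?b i \<le> ?n div r + 1" if "i < r" for i
    using T.class_size_lower[OF colT, of i] T.class_size_upper[OF colT, of i] that by simp
  ultimately obtain p where p: "bij_betw p {..<r} {..<r}" "\<And>i. i < r \<Longrightarrow> ?a i = ?b (p i)"
    using ex_bij_matching_sizes[of r "?n div r" ?a ?b] by blast
  have "\<forall>i\<in>{..<r}. \<exists>h. bij_betw h {w \<in> V. c w = i} {w \<in> {..<?n}. w mod r = p i}"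
    using p(2) V by (intro ballI finite_same_card_bij) auto
  then obtain h where h: "\<And>i. i < r \<Longrightarrow> bij_betw (h i) {w \<in> V. c w = i} {w \<in> {..<?n}. w mod r = p i}"
    by (metis lessThan_iff)
  define f where "f v = h (c v) v" for v
  have cr: "c v < r" if "v \<in> V" for v using turan_colouringD(2)[OF col] that by auto
  have f: "f v < ?n" "f v mod r = p (c v)" if "v \<in> V" for v
    using bij_betw_apply[OF h[OF cr[OF that]], of v] that by (auto simp: f_def)
  have p_inj: "p (c u) = p (c v) \<longleftrightarrow> c u = c v" if "u \<in> V" "v \<in> V" for u v
    using p(1) cr that by (auto simp: bij_betw_def inj_on_eq_iff)
  have inj: "inj_on f V"
  proof (rule inj_onI)
    fix u v assume uv: "u \<in> V" "v \<in> V" "f u = f v"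
    then have "p (c u) = p (c v)" using f by metis
    then have eq: "c u = c v" using p_inj uv by simp
    with uv have "h (c u) u = h (c u) v" by (simp add: f_def)
    then show "u = v" using h[OF cr[OF uv(1)]] eq uv by (auto simp: bij_betw_def dest: inj_onD)
  qed
  have "f ` V = {..<?n}"
    using inj f by (intro card_subset_eq) (auto simp: card_image)
  with inj have "bij_betw f V {..<?n}" by (simp add: bij_betw_def)
  moreover have "{u, v} \<in> E \<longleftrightarrow> {f u, f v} \<in> ?T" if "u \<in> V" "v \<in> V" for u v
    using turan_colouringD(4)[OF col that] T.turan_colouringD(4)[OF colT, of "f u" "f v"] f that p_inj[OF that] by simp
  ultimately show ?thesis
    unfolding graph_isomorphic_def by (auto simp: turan_graph_def complete_multipartite_def)
qed

theorem theorem1: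
  fixes r s n :: nat and G :: "'a ugraph"
  assumes "r \<ge> s" and "s \<ge> 2" and "n > r ^ 8"
    and "finite_simple_graph G" and "card (uverts G) = n"
    and "num_cliques s G \<ge> num_cliques s (turan_graph r n)"
    and "\<not> graph_isomorphic G (turan_graph r n)"
  shows "real (joint_number (r + 1) G) > real n ^ (r - 1) / (4 * real r) ^ (r + 6)"
proof (rule ccontr)
  assume neg: "\<not> ?thesis"
  define V where "V = uverts G"
  define E where "E = uedges G"
  have G: "G = (V, E)" by (simp add: V_def E_def)
  have fin: "finite V" and EV: "E \<subseteq> [V]\<^bsup>2\<^esup>"
    using assms(4) by (auto simp: finite_simple_graph_def G)
  have r: "0 < r" using assms by simp
  interpret loopless E
  proof
    show "{v} \<notin> E" for v using EV by (auto simp: nsets_def)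
  qed
  have "\<exists>c. turan_colouring {..<r} c V"
  proof (rule joints_extremal[OF fin _ assms(2,1)])
    show "real (joint_number (r + 1) G) \<le> real (card V) ^ (r - 1) / (4 * real r) ^ (r + 6)"
      using neg assms(5) by (simp add: V_def)
    show "turan_num r (card V) s \<le> k s V"
      using assms(5,6) num_cliques_turan_graph[OF r] by (simp add: G)
    fix e assume e: "e \<in> clq 2 V"
    then have "e \<in> E" by (auto simp: clq_iff card_2_iff)
    have "k (r - 1) (common_nbrs V e) = card {K \<in> clq (r - 1 + 2) V. e \<subseteq> K}"
      by (rule card_clq_superset[OF e, symmetric])
    also have "\<dots> = card {K \<in> cliques (r + 1) G. e \<subseteq> K}" using r by (simp add: G)
    \<comment> \<open>The description of the joint number as a maximum over edges needs an edge, and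
      \<open>e\<close> is one.\<close>
    also have "\<dots> \<le> joint_number (r + 1) G"
      using \<open>e \<in> E\<close> finite_subset[OF EV finite_imp_finite_nsets[OF fin]]
      unfolding E_def by (subst joint_number_eq_Max_edges[OF assms(4)]) auto
    finally show "real (k (r - 1) (common_nbrs V e)) \<le> real (joint_number (r + 1) G)" by simp
  qed (use assms in \<open>simp_all add: V_def\<close>)
  then obtain c where "turan_colouring {..<r} c V" by blast
  from turan_colouring_isomorphic[OF loopless_axioms fin r this]
  have "graph_isomorphic G (turan_graph r n)" using assms(5) by (simp add: G)
  with assms(7) show False by contradiction
qed

end
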